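(* Let $M$ be a smooth manifold endowed with a $C^0$ Carnot-Carathéodory structure given by continuous vector fields $X_1,\dots,X_m$ (not assumed to be bracket-generating nor linearly independent), and let $d$ be its Carnot-Carathéodory distance. Then for every $p\in M$ and every $\varepsilon>0$ there exist a neighbourhood $V$ of $p$ (with respect to the manifold topology of $M$) and $\bar r_\varepsilon>0$ such that $$2r(1-\varepsilon)\le \mathrm{diam}(B(q,r))\le 2r\qquad\text{for every }0<r<\bar r_\varepsilon\text{ and every }q\in V.$$
   Context: A $C^0$ Carnot-Carathéodory space (or structure) of dimension $n$ is a connected smooth manifold $M$ of dimension $n$ endowed with a family of continuous vector fields $X_1,\dots,X_m$ such that for every $p\in M$ there exists $1\le i\le m$ with $X_i(p)\neq 0$. The vector fields are required to be neither bracket-generating nor linearly independent. An admissible curve joining $p$ and $q$ is an absolutely continuous curve $\gamma:[a,b]\to M$ with $\gamma(a)=p$, $\gamma(b)=q$ for which there exists a measurable function $h:[a,b]\to\mathbb{R}^m$ such that $\dot\gamma(t)=\sum_{j=1}^m h_j(t)X_j(\gamma(t))$ for a.e. $t\in[a,b]$. For an admissible curve $\gamma$, $h_\gamma:[a,b]\to\mathbb{R}^m$ denotes the (measurable) function such that, for a.e. $t$, $h_\gamma(t)$ is the element of minimal Euclidean norm in the affine space $\{u\in\mathbb{R}^m:\dot\gamma(t)=\sum_{j=1}^m u_jX_j(\gamma(t))\}$. The length of $\gamma$ is $L(\gamma)=\int_a^b|h_\gamma(t)|\,dt$ (Euclidean norm in $\mathbb{R}^m$). The Carnot-Carathéodory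 distance is $d(p,q)=\inf\{L(\gamma):\gamma\text{ is an admissible curve joining }p\text{ and }q\}$, with $\inf\emptyset=+\infty$ (so $d$ takes values in $[0,+\infty]$). $B(q,r)=\{x\in M:d(q,x)<r\}$ is the open ball for $d$, and $\mathrm{diam}(E)=\sup\{d(x,y):x,y\in E\}$. *)

theory Defs
  imports "HOL-Analysis.Analysis"
begin

text \<open>
  The manifold is a whole type \<open>'a\<close> (Hausdorff, second countable), its smooth structure is given by
  an atlas of charts \<open>(U, \<phi>)\<close> with \<open>\<phi> : U \<rightarrow> \<real>\<^sup>n\<close>, \<open>n = CARD('n)\<close>. The dimension \<open>0\<close> is no loss: there every
  vector field vanishes.
\<close>

type_synonym ('a, 'n) chart = "'a set \<times> ('a \<Rightarrow> real ^ 'n)"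

abbreviation chart_dom :: "('a, 'n) chart \<Rightarrow> 'a set" where
  "chart_dom c \<equiv> fst c"

abbreviation chart_map :: "('a, 'n) chart \<Rightarrow> 'a \<Rightarrow> real ^ 'n" where
  "chart_map c \<equiv> snd c"

text \<open>\<open>C\<^sup>k\<close> maps on an open set \<open>S\<close>.\<close>

primrec Ck_on :: "nat \<Rightarrow> 'a::real_normed_vector set \<Rightarrow> ('a \<Rightarrow> 'b::real_normed_vector) \<Rightarrow> bool" where
  "Ck_on 0 S f \<longleftrightarrow> continuous_on S f"
| "Ck_on (Suc k) S f \<longleftrightarrow>
     (\<forall>x\<in>S. f differentiable (at x)) \<and> (\<forall>v. Ck_on k S (\<lambda>x. frechet_derivative f (at x) v))"

definition smooth_on :: "'a::real_normed_vector set \<Rightarrow> ('a \<Rightarrow> 'b::real_normed_vector) \<Rightarrow> bool" where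
  "smooth_on S f \<longleftrightarrow> (\<forall>k. Ck_on k S f)"

definition is_chart :: "('a::topological_space, 'n::finite) chart \<Rightarrow> bool" where
  "is_chart c \<longleftrightarrow> open (chart_dom c) \<and> open (chart_map c ` chart_dom c) \<and>
     (\<exists>\<psi>. homeomorphism (chart_dom c) (chart_map c ` chart_dom c) (chart_map c) \<psi>)"

definition transition :: "('a, 'n) chart \<Rightarrow> ('a, 'n) chart \<Rightarrow> real ^ 'n \<Rightarrow> real ^ 'n" where
  "transition c c' = chart_map c' \<circ> inv_into (chart_dom c) (chart_map c)"

definition smooth_atlas :: "('a::topological_space, 'n::finite) chart set \<Rightarrow> bool" where
  "smooth_atlas A \<longleftrightarrow> (\<forall>c\<in>A. is_chart c) \<and> (\<Union>c\<in>A. chart_dom c) = UNIV \<and>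
     (\<forall>c\<in>A. \<forall>c'\<in>A. smooth_on (chart_map c ` (chart_dom c \<inter> chart_dom c')) (transition c c'))"

text \<open>
  A tangent vector at \<open>p\<close> is the family of its coordinate vectors in the charts around \<open>p\<close>, related by
  the differentials of the transition maps. Its values at charts that do not contain \<open>p\<close> are irrelevant.
\<close>

type_synonym ('a, 'n) tvec = "('a, 'n) chart \<Rightarrow> real ^ 'n"

definition tangent_vector :: "('a, 'n::finite) chart set \<Rightarrow> 'a \<Rightarrow> ('a, 'n) tvec \<Rightarrow> bool" where
  "tangent_vector A p v \<longleftrightarrow> (\<forall>c\<in>A. \<forall>c'\<in>A. p \<in> chart_dom c \<inter> chart_dom c' \<longrightarrow>
     v c' = frechet_derivative (transition c c') (at (chart_map c p)) (v c))"

definition nonzero_tvec :: "('a, 'n::finite) chart set \<Rightarrow> 'a \<Rightarrow> ('a, 'n) tvec \<Rightarrow> bool" where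
  "nonzero_tvec A p v \<longleftrightarrow> (\<forall>c\<in>A. p \<in> chart_dom c \<longrightarrow> v c \<noteq> 0)"

definition continuous_vector_field ::
  "('a::topological_space, 'n::finite) chart set \<Rightarrow> ('a \<Rightarrow> ('a, 'n) tvec) \<Rightarrow> bool" where
  "continuous_vector_field A Y \<longleftrightarrow>
     (\<forall>p. tangent_vector A p (Y p)) \<and> (\<forall>c\<in>A. continuous_on (chart_dom c) (\<lambda>p. Y p c))"

text \<open>\<open>X j p\<close> is the value at \<open>p\<close> of the \<open>j\<close>-th vector field, \<open>j\<close> ranging over a type with \<open>m = CARD('m)\<close>
  elements.\<close>

definition CC_structure ::
  "('a::{t2_space,second_countable_topology}, 'n::finite) chart set \<Rightarrow>
   ('m::finite \<Rightarrow> 'a \<Rightarrow> ('a, 'n) tvec) \<Rightarrow> bool" where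
  "CC_structure A X \<longleftrightarrow> smooth_atlas A \<and> connected (UNIV :: 'a set) \<and>
     (\<forall>j. continuous_vector_field A (X j)) \<and> (\<forall>p. \<exists>j. nonzero_tvec A p (X j p))"

definition has_velocity ::
  "('a, 'n::finite) chart set \<Rightarrow> (real \<Rightarrow> 'a) \<Rightarrow> real \<Rightarrow> real \<Rightarrow> real \<Rightarrow> ('a, 'n) tvec \<Rightarrow> bool" where
  "has_velocity A \<gamma> a b t v \<longleftrightarrow> (\<forall>c\<in>A. \<gamma> t \<in> chart_dom c \<longrightarrow>
     ((chart_map c \<circ> \<gamma>) has_vector_derivative v c) (at t within {a..b}))"

text \<open>Absolute continuity on \<open>[a,b]\<close>: the usual \<open>\<epsilon>\<close>-\<open>\<delta>\<close> condition over finite families \<open>I\<close> of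
  non-overlapping subintervals, given by their pairs of endpoints.\<close>

definition abs_continuous :: "real \<Rightarrow> real \<Rightarrow> (real \<Rightarrow> 'b::metric_space) \<Rightarrow> bool" where
  "abs_continuous a b f \<longleftrightarrow> (\<forall>\<epsilon>>0. \<exists>\<delta>>0. \<forall>I.
     finite I \<and> (\<forall>(s, t)\<in>I. a \<le> s \<and> s \<le> t \<and> t \<le> b) \<and>
     pairwise (\<lambda>i j. disjnt {fst i<..<snd i} {fst j<..<snd j}) I \<and> (\<Sum>(s, t)\<in>I. t - s) < \<delta>
     \<longrightarrow> (\<Sum>(s, t)\<in>I. dist (f s) (f t)) < \<epsilon>)"

definition abs_continuous_curve ::
  "('a::topological_space, 'n::finite) chart set \<Rightarrow> real \<Rightarrow> real \<Rightarrow> (real \<Rightarrow> 'a) \<Rightarrow> bool" where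
  "abs_continuous_curve A a b \<gamma> \<longleftrightarrow> continuous_on {a..b} \<gamma> \<and>
     (\<forall>c\<in>A. \<forall>s t. a \<le> s \<and> s \<le> t \<and> t \<le> b \<and> \<gamma> ` {s..t} \<subseteq> chart_dom c
        \<longrightarrow> abs_continuous s t (chart_map c \<circ> \<gamma>))"

text \<open>The affine space of all \<open>u \<in> \<real>\<^sup>m\<close> with \<open>\<gamma>'(t) = \<Sum>\<^sub>j u\<^sub>j X\<^sub>j(\<gamma>(t))\<close> (empty if \<open>\<gamma>'(t)\<close> does not exist).\<close>

definition controls ::
  "('a, 'n::finite) chart set \<Rightarrow> ('m::finite \<Rightarrow> 'a \<Rightarrow> ('a, 'n) tvec) \<Rightarrow>
   real \<Rightarrow> real \<Rightarrow> (real \<Rightarrow> 'a) \<Rightarrow> real \<Rightarrow> (real ^ 'm) set" where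
  "controls A X a b \<gamma> t =
     {u. has_velocity A \<gamma> a b t (\<lambda>c. \<Sum>j\<in>UNIV. (u $ j) *\<^sub>R X j (\<gamma> t) c)}"

definition admissible ::
  "('a::topological_space, 'n::finite) chart set \<Rightarrow> ('m::finite \<Rightarrow> 'a \<Rightarrow> ('a, 'n) tvec) \<Rightarrow>
   real \<Rightarrow> real \<Rightarrow> (real \<Rightarrow> 'a) \<Rightarrow> 'a \<Rightarrow> 'a \<Rightarrow> bool" where
  "admissible A X a b \<gamma> p q \<longleftrightarrow> a < b \<and> abs_continuous_curve A a b \<gamma> \<and> \<gamma> a = p \<and> \<gamma> b = q \<and>
     (\<exists>h :: real \<Rightarrow> real ^ 'm. h \<in> borel_measurable (lebesgue_on {a..b}) \<and>
        (AE t in lebesgue_on {a..b}. h t \<in> controls A X a b \<gamma> t))"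

text \<open>The values of \<open>min_control\<close> at the (null set of) times \<open>t\<close> without any control are irrelevant.\<close>

definition min_control ::
  "('a, 'n::finite) chart set \<Rightarrow> ('m::finite \<Rightarrow> 'a \<Rightarrow> ('a, 'n) tvec) \<Rightarrow>
   real \<Rightarrow> real \<Rightarrow> (real \<Rightarrow> 'a) \<Rightarrow> real \<Rightarrow> real ^ 'm" where
  "min_control A X a b \<gamma> t = arg_min norm (\<lambda>u. u \<in> controls A X a b \<gamma> t)"

definition CC_length ::
  "('a, 'n::finite) chart set \<Rightarrow> ('m::finite \<Rightarrow> 'a \<Rightarrow> ('a, 'n) tvec) \<Rightarrow>
   real \<Rightarrow> real \<Rightarrow> (real \<Rightarrow> 'a) \<Rightarrow> ennreal" where
  "CC_length A X a b \<gamma> = (\<integral>\<^sup>+ t. ennreal (norm (min_control A X a b \<gamma> t)) \<partial>lebesgue_on {a..b})"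

definition CC_dist ::
  "('a::topological_space, 'n::finite) chart set \<Rightarrow> ('m::finite \<Rightarrow> 'a \<Rightarrow> ('a, 'n) tvec) \<Rightarrow>
   'a \<Rightarrow> 'a \<Rightarrow> ennreal" where
  "CC_dist A X p q = Inf {CC_length A X a b \<gamma> | a b \<gamma>. admissible A X a b \<gamma> p q}"

definition CC_ball ::
  "('a::topological_space, 'n::finite) chart set \<Rightarrow> ('m::finite \<Rightarrow> 'a \<Rightarrow> ('a, 'n) tvec) \<Rightarrow>
   'a \<Rightarrow> real \<Rightarrow> 'a set" where
  "CC_ball A X q r = {x. CC_dist A X q x < ennreal r}"

definition CC_diam ::
  "('a::topological_space, 'n::finite) chart set \<Rightarrow> ('m::finite \<Rightarrow> 'a \<Rightarrow> ('a, 'n) tvec) \<Rightarrow>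
   'a set \<Rightarrow> ennreal" where
  "CC_diam A X E = (SUP x\<in>E. SUP y\<in>E. CC_dist A X x y)"

end

theory Submission
  imports Defs "HOL-Complex_Analysis.Great_Picard"
begin

text \<open>
  Upper bound: a curve from \<open>q\<close> to \<open>x\<close> can be run backwards at the same cost and followed by a curve
  from \<open>q\<close> to \<open>y\<close>, so two points of \<open>B(q,r)\<close> are at distance at most \<open>2 r\<close> (\<open>admissible_reflect\<close>,
  \<open>admissible_concat\<close>, \<open>CC_diam_ball_le\<close>). This needs no regularity of the vector fields.

  Lower bound: fix a chart \<open>c\<close> around \<open>p\<close> and write \<open>G y h = \<Sum>\<^sub>j h\<^sub>j X\<^sub>j(y)\<close> in that chart. Let the unit
  vector \<open>u\<close> maximise \<open>\<bar>G p h\<bar>\<close> over the unit sphere, put \<open>w = G p u\<close> and \<open>\<sigma> = \<bar>w\<bar>\<close>; then \<open>\<sigma> > 0\<close>, since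
  some \<open>X\<^sub>j(p)\<close> is nonzero. At \<open>p\<close> we have \<open>w \<bullet> G p u = \<sigma>\<^sup>2\<close> and \<open>\<bar>w \<bullet> G p h\<bar> \<le> \<sigma>\<^sup>2 \<bar>h\<bar>\<close>, so among all curves
  of unit speed those with control \<open>u\<close> are, to first order, the fastest in the direction of the linear functional
  \<open>w\<close>; by continuity this persists near \<open>p\<close> up to a factor close to \<open>1\<close>. From \<open>q\<close> near \<open>p\<close>, follow integral
  curves of \<open>G y u\<close> and of \<open>- G y u\<close> for a time \<open>s\<close> slightly smaller than \<open>r\<close>. The endpoints \<open>y\<^sub>1\<close>, \<open>y\<^sub>2\<close> lie
  in \<open>B(q,r)\<close>, and \<open>w\<close> separates them by almost \<open>2 s \<sigma>\<^sup>2\<close>. A curve joining them inside the chart ball has length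
  at least this gap divided by the maximal slope of \<open>w\<close>, which is close to \<open>\<sigma>\<^sup>2\<close>, hence almost \<open>2 s\<close>
  (\<open>curve_functional_bound\<close>); a curve leaving the chart ball is too long anyway (\<open>curve_confined\<close>).

  Two analytic facts carry this. The vector fields are merely continuous, so the integral curves come from Peano's
  theorem (\<open>peano_existence\<close>), which is proved here by Tonelli's delayed equations. Admissible curves
  are merely absolutely continuous, so the comparison of \<open>w\<close> along a curve with its length rests on the
  fundamental theorem of calculus for absolutely continuous functions (\<open>abs_continuous_has_integral\<close>).

  Measurability of the minimal control is not needed: all integrals of its norm
  are lower integrals (suprema over simple functions below), and the few rules needed hold for these.
\<close>

section \<open>Absolutely continuous functions\<close>

text \<open>The finite families of intervals, given by their endpoints, over which absolute continuity on
  \<open>[a,b]\<close> is tested.\<close>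
definition nonoverlapping :: "real \<Rightarrow> real \<Rightarrow> (real \<times> real) set \<Rightarrow> bool" where
  "nonoverlapping a b I \<longleftrightarrow> finite I \<and> (\<forall>(s, t)\<in>I. a \<le> s \<and> s \<le> t \<and> t \<le> b) \<and>
     pairwise (\<lambda>i j. disjnt {fst i<..<snd i} {fst j<..<snd j}) I"

lemma abs_continuousI:
  assumes "\<And>e. e > 0 \<Longrightarrow> \<exists>d>0. \<forall>I. nonoverlapping a b I \<longrightarrow> (\<Sum>(s, t)\<in>I. t - s) < d
     \<longrightarrow> (\<Sum>(s, t)\<in>I. dist (f s) (f t)) < e"
  shows "abs_continuous a b f"
  unfolding abs_continuous_def
proof (intro allI impI)
  fix e :: real assume "e > 0"
  from assms[OF this] show "\<exists>\<delta>>0. \<forall>I. finite I \<and> (\<forall>(s, t)\<in>I. a \<le> s \<and> s \<le> t \<and> t \<le> b) \<and>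
     pairwise (\<lambda>i j. disjnt {fst i<..<snd i} {fst j<..<snd j}) I \<and> (\<Sum>(s, t)\<in>I. t - s) < \<delta>
     \<longrightarrow> (\<Sum>(s, t)\<in>I. dist (f s) (f t)) < e"
    unfolding nonoverlapping_def by meson
qed

lemma abs_continuousE:
  assumes "abs_continuous a b f" "e > 0"
  obtains d where "d > 0" "\<And>I. nonoverlapping a b I \<Longrightarrow> (\<Sum>(s, t)\<in>I. t - s) < d
     \<Longrightarrow> (\<Sum>(s, t)\<in>I. dist (f s) (f t)) < e"
  using assms unfolding abs_continuous_def nonoverlapping_def by meson

lemma abs_continuousI_dist_le:
  assumes "abs_continuous a b f" "L \<ge> 0"
    and "\<And>s t. a \<le> s \<Longrightarrow> s \<le> t \<Longrightarrow> t \<le> b \<Longrightarrow> dist (g s) (g t) \<le> L * dist (f s) (f t)"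
  shows "abs_continuous a b g"
proof (rule abs_continuousI)
  fix e :: real assume "e > 0"
  then have "e / (L + 1) > 0" using \<open>L \<ge> 0\<close> by simp
  with assms(1) obtain d where "d > 0" and d: "\<And>I. nonoverlapping a b I \<Longrightarrow> (\<Sum>(s, t)\<in>I. t - s) < d
     \<Longrightarrow> (\<Sum>(s, t)\<in>I. dist (f s) (f t)) < e / (L + 1)"
    by (rule abs_continuousE) blast
  have "(\<Sum>(s, t)\<in>I. dist (g s) (g t)) < e"
    if I: "nonoverlapping a b I" "(\<Sum>(s, t)\<in>I. t - s) < d" for I
  proof -
    have "(\<Sum>(s, t)\<in>I. dist (g s) (g t)) \<le> (\<Sum>(s, t)\<in>I. L * dist (f s) (f t))"
      using I(1) assms(3) unfolding nonoverlapping_def by (intro sum_mono) auto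
    also have "\<dots> = L * (\<Sum>(s, t)\<in>I. dist (f s) (f t))"
      by (simp add: sum_distrib_left case_prod_unfold)
    also have "\<dots> \<le> (L + 1) * (\<Sum>(s, t)\<in>I. dist (f s) (f t))"
      by (intro mult_right_mono sum_nonneg) auto
    also have "\<dots> < e" using d[OF I] \<open>L \<ge> 0\<close> by (simp add: field_simps)
    finally show ?thesis .
  qed
  then show "\<exists>d>0. \<forall>I. nonoverlapping a b I \<longrightarrow> (\<Sum>(s, t)\<in>I. t - s) < d
     \<longrightarrow> (\<Sum>(s, t)\<in>I. dist (g s) (g t)) < e"
    using \<open>d > 0\<close> by blast
qed

lemma abs_continuous_id: "abs_continuous a b (\<lambda>t::real. t)"
proof (rule abs_continuousI)
  fix e :: real assume "e > 0"
  have "(\<Sum>(s, t)\<in>I. dist s t) = (\<Sum>(s, t)\<in>I. t - s)" if "nonoverlapping a b I" for I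
    using that unfolding nonoverlapping_def by (intro sum.cong) (auto simp: dist_real_def)
  then show "\<exists>d>0. \<forall>I. nonoverlapping a b I \<longrightarrow> (\<Sum>(s, t)\<in>I. t - s) < d
     \<longrightarrow> (\<Sum>(s, t)\<in>I. dist s t) < e"
    using \<open>e > 0\<close> by (intro exI[of _ e]) simp
qed

lemma abs_continuous_reflect:
  assumes "abs_continuous (k - t) (k - s) f"
  shows "abs_continuous s t (\<lambda>r. f (k - r))"
proof (rule abs_continuousI)
  fix e :: real assume "e > 0"
  with assms obtain d where "d > 0" and d: "\<And>I. nonoverlapping (k - t) (k - s) I \<Longrightarrow> (\<Sum>(x, y)\<in>I. y - x) < d
     \<Longrightarrow> (\<Sum>(x, y)\<in>I. dist (f x) (f y)) < e"
    by (rule abs_continuousE) blast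
  have "(\<Sum>(x, y)\<in>I. dist (f (k - x)) (f (k - y))) < e"
    if I: "nonoverlapping s t I" "(\<Sum>(x, y)\<in>I. y - x) < d" for I
  proof -
    let ?R = "\<lambda>i::real \<times> real. (k - snd i, k - fst i)"
    have inj: "inj_on ?R I" by (auto simp: inj_on_def)
    have "nonoverlapping (k - t) (k - s) (?R ` I)"
      unfolding nonoverlapping_def
    proof (intro conjI)
      show "finite (?R ` I)" "\<forall>(x, y)\<in>?R ` I. k - t \<le> x \<and> x \<le> y \<and> y \<le> k - s"
        using I(1) by (auto simp: nonoverlapping_def)
      have dis: "disjnt {k - snd i<..<k - fst i} {k - snd j<..<k - fst j}"
        if "disjnt {fst i<..<snd i} {fst j<..<snd j}" for i j :: "real \<times> real"
        unfolding disjnt_iff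
      proof (intro allI notI)
        fix r assume "r \<in> {k - snd i<..<k - fst i} \<and> r \<in> {k - snd j<..<k - fst j}"
        then have "k - r \<in> {fst i<..<snd i} \<and> k - r \<in> {fst j<..<snd j}" by auto
        then show False using that unfolding disjnt_iff by blast
      qed
      show "pairwise (\<lambda>i j. disjnt {fst i<..<snd i} {fst j<..<snd j}) (?R ` I)"
      proof (rule pairwiseI)
        fix i j assume "i \<in> ?R ` I" "j \<in> ?R ` I" "i \<noteq> j"
        then obtain i' j' where ij: "i' \<in> I" "j' \<in> I" "i = ?R i'" "j = ?R j'" by blast
        with \<open>i \<noteq> j\<close> have "i' \<noteq> j'" by blast
        with I(1) ij(1,2) have "disjnt {fst i'<..<snd i'} {fst j'<..<snd j'}"
          unfolding nonoverlapping_def pairwise_def by blast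
        from dis[OF this] show "disjnt {fst i<..<snd i} {fst j<..<snd j}"
          unfolding ij(3,4) by simp
      qed
    qed
    moreover have "(\<Sum>(x, y)\<in>?R ` I. y - x) < d"
      using I(2) by (simp add: sum.reindex[OF inj] case_prod_unfold)
    ultimately have "(\<Sum>(x, y)\<in>?R ` I. dist (f x) (f y)) < e" by (rule d)
    then show ?thesis by (simp add: sum.reindex[OF inj] case_prod_unfold dist_commute)
  qed
  then show "\<exists>d>0. \<forall>I. nonoverlapping s t I \<longrightarrow> (\<Sum>(x, y)\<in>I. y - x) < d
     \<longrightarrow> (\<Sum>(x, y)\<in>I. dist (f (k - x)) (f (k - y))) < e"
    using \<open>d > 0\<close> by blast
qed

text \<open>At most one interval of a nonoverlapping family contains \<open>c\<close> in its interior; continuity takes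
  care of it.\<close>
lemma abs_continuous_concat:
  assumes 1: "abs_continuous a c f" and 2: "abs_continuous c b f"
    and cont: "continuous_on {a..b} f" and "a \<le> c" "c \<le> b"
  shows "abs_continuous a b f"
proof (rule abs_continuousI)
  fix e :: real assume "e > 0"
  then have e3: "e / 3 > 0" by simp
  obtain d1 where "d1 > 0" and d1: "\<And>I. nonoverlapping a c I \<Longrightarrow> (\<Sum>(x, y)\<in>I. y - x) < d1
     \<Longrightarrow> (\<Sum>(x, y)\<in>I. dist (f x) (f y)) < e / 3"
    using 1 e3 by (rule abs_continuousE) blast
  obtain d2 where "d2 > 0" and d2: "\<And>I. nonoverlapping c b I \<Longrightarrow> (\<Sum>(x, y)\<in>I. y - x) < d2
     \<Longrightarrow> (\<Sum>(x, y)\<in>I. dist (f x) (f y)) < e / 3"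
    using 2 e3 by (rule abs_continuousE) blast
  have "uniformly_continuous_on {a..b} f"
    using cont by (intro compact_uniformly_continuous) auto
  then obtain d3 where "d3 > 0" and d3: "\<And>x y. x \<in> {a..b} \<Longrightarrow> y \<in> {a..b} \<Longrightarrow> dist y x < d3 \<Longrightarrow> dist (f y) (f x) < e / 3"
    using e3 unfolding uniformly_continuous_on_def by meson
  define d where "d = min d1 (min d2 d3)"
  have "(\<Sum>(x, y)\<in>I. dist (f x) (f y)) < e"
    if I: "nonoverlapping a b I" "(\<Sum>(x, y)\<in>I. y - x) < d" for I
  proof -
    have fin: "finite I" and bd: "\<And>x y. (x, y) \<in> I \<Longrightarrow> a \<le> x \<and> x \<le> y \<and> y \<le> b"
      and pw: "pairwise (\<lambda>i j. disjnt {fst i<..<snd i} {fst j<..<snd j}) I"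
      using I(1) by (auto simp: nonoverlapping_def)
    define I1 where "I1 = {i \<in> I. snd i \<le> c}"
    define I2 where "I2 = {i \<in> I. c < snd i \<and> c \<le> fst i}"
    define I3 where "I3 = {i \<in> I. fst i < c \<and> c < snd i}"
    have sub: "I1 \<subseteq> I" "I2 \<subseteq> I" "I3 \<subseteq> I" by (auto simp: I1_def I2_def I3_def)
    have less: "(\<Sum>(x, y)\<in>J. y - x) < d" if "J \<subseteq> I" for J
    proof -
      have "(\<Sum>(x, y)\<in>J. y - x) \<le> (\<Sum>(x, y)\<in>I. y - x)"
        using fin that bd by (intro sum_mono2) fastforce+
      then show ?thesis using I(2) by simp
    qed
    have "nonoverlapping a c I1"
      using bd pairwise_subset[OF pw sub(1)] finite_subset[OF sub(1) fin]
      by (auto simp: nonoverlapping_def I1_def)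
    moreover have "(\<Sum>(x, y)\<in>I1. y - x) < d1" using less[OF sub(1)] by (simp add: d_def)
    ultimately have S1: "(\<Sum>(x, y)\<in>I1. dist (f x) (f y)) < e / 3" by (rule d1)
    have "nonoverlapping c b I2"
      using bd pairwise_subset[OF pw sub(2)] finite_subset[OF sub(2) fin]
      by (auto simp: nonoverlapping_def I2_def)
    moreover have "(\<Sum>(x, y)\<in>I2. y - x) < d2" using less[OF sub(2)] by (simp add: d_def)
    ultimately have S2: "(\<Sum>(x, y)\<in>I2. dist (f x) (f y)) < e / 3" by (rule d2)
    have S3: "(\<Sum>(x, y)\<in>I3. dist (f x) (f y)) < e / 3"
    proof (cases "I3 = {}")
      case False
      then obtain i where i: "i \<in> I3" by blast
      have "j = i" if "j \<in> I3" for j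
      proof (rule ccontr)
        assume "j \<noteq> i"
        moreover have "i \<in> I" "j \<in> I" using i that sub(3) by auto
        ultimately have "disjnt {fst i<..<snd i} {fst j<..<snd j}"
          using pairwiseD[OF pw] by metis
        moreover have "c \<in> {fst i<..<snd i}" "c \<in> {fst j<..<snd j}" using i that by (auto simp: I3_def)
        ultimately show False by (auto simp: disjnt_iff)
      qed
      then have I3: "I3 = {i}" using i by blast
      obtain x y where xy: "i = (x, y)" by (cases i)
      have "a \<le> x \<and> x \<le> y \<and> y \<le> b" using bd i sub(3) xy by blast
      moreover have "y - x < d" using less[OF sub(3)] I3 xy by simp
      ultimately have "dist (f x) (f y) < e / 3" by (intro d3) (auto simp: dist_real_def d_def)
      then show ?thesis using I3 xy by simp
    qed (use \<open>e > 0\<close> in simp)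
    have "I = I1 \<union> I2 \<union> I3" "I1 \<inter> I2 = {}" "(I1 \<union> I2) \<inter> I3 = {}"
      by (auto simp: I1_def I2_def I3_def)
    moreover have "finite I1" "finite I2" "finite I3" using sub fin by (auto intro: finite_subset)
    ultimately have "(\<Sum>(x, y)\<in>I. dist (f x) (f y)) = (\<Sum>(x, y)\<in>I1. dist (f x) (f y))
       + (\<Sum>(x, y)\<in>I2. dist (f x) (f y)) + (\<Sum>(x, y)\<in>I3. dist (f x) (f y))"
      by (simp add: sum.union_disjoint)
    then show ?thesis using S1 S2 S3 by linarith
  qed
  moreover have "d > 0" using \<open>d1 > 0\<close> \<open>d2 > 0\<close> \<open>d3 > 0\<close> by (simp add: d_def)
  ultimately show "\<exists>d>0. \<forall>I. nonoverlapping a b I \<longrightarrow> (\<Sum>(x, y)\<in>I. y - x) < d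
     \<longrightarrow> (\<Sum>(x, y)\<in>I. dist (f x) (f y)) < e"
    by blast
qed

text \<open>The fundamental theorem of calculus for an absolutely continuous function that is differentiable off
  a null set \<open>N\<close>. In a Riemann sum, the tags outside \<open>N\<close> are handled by differentiability; those in \<open>N\<close>
  can be forced into an open set of small measure, where absolute continuity makes the increments of \<open>f\<close>
  small.\<close>
lemma abs_continuous_has_integral:
  fixes f :: "real \<Rightarrow> 'b::real_normed_vector"
  assumes "a \<le> b" and ac: "abs_continuous a b f" and N: "N \<in> null_sets lebesgue"
    and der: "\<And>t. t \<in> {a..b} - N \<Longrightarrow> (f has_vector_derivative g t) (at t within {a..b})"
  shows "((\<lambda>t. if t \<in> N then 0 else g t) has_integral (f b - f a)) {a..b}"
  unfolding has_integral_real
proof (intro allI impI)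
  let ?g = "\<lambda>t. if t \<in> N then 0 else g t"
  fix e :: real assume "e > 0"
  define e1 where "e1 = e / (2 * (b - a + 1))"
  have e1: "e1 > 0" "e1 * (b - a) < e / 2"
    using \<open>e > 0\<close> \<open>a \<le> b\<close> by (auto simp: e1_def field_simps)
  from \<open>e > 0\<close> have "e / 2 > 0" by simp
  with ac obtain \<delta> where "\<delta> > 0" and \<delta>: "\<And>I. nonoverlapping a b I \<Longrightarrow> (\<Sum>(s, t)\<in>I. t - s) < \<delta>
     \<Longrightarrow> (\<Sum>(s, t)\<in>I. dist (f s) (f t)) < e / 2"
    by (rule abs_continuousE) blast
  obtain U where U: "open U" "N \<subseteq> U" "U - N \<in> lmeasurable" "emeasure lebesgue (U - N) < ennreal \<delta>"
    using sets_lebesgue_outer_open[of N \<delta>] N \<open>\<delta> > 0\<close> by (auto simp: null_sets_def)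
  have emU: "emeasure lebesgue U < ennreal \<delta>"
  proof -
    have "emeasure lebesgue U = emeasure lebesgue (U - N)"
      using emeasure_Diff_null_set[OF N, of U] U(1) by auto
    then show ?thesis using U by simp
  qed
  have "\<exists>d>0. (x \<in> N \<longrightarrow> ball x d \<subseteq> U) \<and> (x \<in> {a..b} - N \<longrightarrow>
         (\<forall>y\<in>{a..b}. norm (y-x) < d \<longrightarrow> norm (f y - f x - (y-x) *\<^sub>R g x) \<le> e1 * norm (y-x)))" for x
  proof (cases "x \<in> N")
    case True
    then obtain d where "d > 0" "ball x d \<subseteq> U" using U by (meson openE subsetD)
    then show ?thesis using True by auto
  next
    case False
    show ?thesis
    proof (cases "x \<in> {a..b}")
      case True
      then have "(f has_vector_derivative g x) (at x within {a..b})" using False der by auto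
      then show ?thesis
        using e1(1) False unfolding has_vector_derivative_def has_derivative_within_alt by blast
    qed (use False in \<open>auto intro: exI[of _ 1]\<close>)
  qed
  then obtain d where d0: "\<And>x. d x > 0" and dN: "\<And>x. x \<in> N \<Longrightarrow> ball x (d x) \<subseteq> U"
    and dG: "\<And>x y. x \<in> {a..b} - N \<Longrightarrow> y\<in>{a..b} \<Longrightarrow> norm (y-x) < d x \<Longrightarrow>
       norm (f y - f x - (y-x) *\<^sub>R g x) \<le> e1 * norm (y-x)"
    by metis
  show "\<exists>\<gamma>. gauge \<gamma> \<and> (\<forall>\<D>. \<D> tagged_division_of {a..b} \<and> \<gamma> fine \<D> \<longrightarrow>
     norm ((\<Sum>(x, k)\<in>\<D>. measure lborel k *\<^sub>R ?g x) - (f b - f a)) < e)"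
  proof (rule exI, safe)
    show "gauge (\<lambda>x. ball x (d x))" using d0 gauge_ball_dependent by blast
    fix p assume p: "p tagged_division_of {a..b}" and fine: "(\<lambda>x. ball x (d x)) fine p"
    have K: "\<exists>u v. K = {u..v} \<and> u \<le> x \<and> x \<le> v \<and> a \<le> u \<and> v \<le> b \<and> Inf K = u \<and> Sup K = v \<and> {u..v} \<subseteq> ball x (d x)"
      if xK: "(x, K) \<in> p" for x K
    proof -
      obtain u v where uv: "K = {u..v}" using tagged_division_ofD(4)[OF p xK] by auto
      have "x \<in> K" "K \<subseteq> {a..b}" using tagged_division_ofD(2,3)[OF p that] by auto
      moreover have "K \<subseteq> ball x (d x)" using fine that by (auto simp: fine_def)
      moreover have "u \<le> x" "x \<le> v" "a \<le> u" "v \<le> b" using \<open>x \<in> K\<close> \<open>K \<subseteq> {a..b}\<close> uv by auto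
      ultimately show ?thesis using uv by (rule_tac x=u in exI, rule_tac x=v in exI) simp
    qed
    have disj: "interior K \<inter> interior K' = {}" if "(x, K) \<in> p" "(x', K') \<in> p" "(x, K) \<noteq> (x', K')" for x K x' K'
      using tagged_division_ofD(5)[OF p that] .
    have fin: "finite p" using tagged_division_ofD(1)[OF p] .
    define pN where "pN = {xK \<in> p. fst xK \<in> N}"
    have ba: "b - a = (\<Sum>(x,K)\<in>p. Sup K - Inf K)" "f b - f a = (\<Sum>(x,K)\<in>p. f (Sup K) - f (Inf K))"
      using additive_tagged_division_1[where f= "\<lambda>x. x"] additive_tagged_division_1[where f= f]
        \<open>a \<le> b\<close> p by auto
    let ?J = "\<lambda>xK::real \<times> real set. (Inf (snd xK), Sup (snd xK))"
    have inj: "inj_on ?J pN"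
    proof (rule inj_onI, clarsimp)
      fix x K x' K' assume *: "(x, K) \<in> pN" "(x', K') \<in> pN" "Inf K = Inf K'" "Sup K = Sup K'"
      then have 1: "(x, K) \<in> p" "(x', K') \<in> p" by (auto simp: pN_def)
      have KK: "K = K'" using K[OF 1(1)] K[OF 1(2)] * by auto
      moreover have "x = x'"
      proof (rule ccontr)
        assume "x \<noteq> x'"
        then have "interior K = {}" using disj[OF 1] KK by auto
        then show False using K[OF 1(1)] K[OF 1(2)] KK \<open>x \<noteq> x'\<close> by fastforce
      qed
      ultimately show "x = x' \<and> K = K'" by simp
    qed
    \<comment> \<open>The intervals with tag in \<open>N\<close>, given by their endpoints.\<close>
    define I where "I = ?J ` pN"
    have I_open: "{s<..<t} \<subseteq> U" if st: "(s, t) \<in> I" for s t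
    proof -
      obtain x K where xK: "(x, K) \<in> p" "x \<in> N" "s = Inf K" "t = Sup K"
        using st by (auto simp: I_def pN_def)
      then show ?thesis using K[OF xK(1)] dN[of x] by fastforce
    qed
    have pw: "pairwise (\<lambda>i j. disjnt {fst i<..<snd i} {fst j<..<snd j}) I"
    proof (rule pairwiseI)
      fix i j assume "i \<in> I" "j \<in> I" "i \<noteq> j"
      moreover have "\<exists>x K. (x, K) \<in> p \<and> i = (Inf K, Sup K)" if "i \<in> I" for i
        using that unfolding I_def pN_def by force
      ultimately obtain x K x' K' where *: "(x, K) \<in> p" "(x', K') \<in> p" "i = (Inf K, Sup K)" "j = (Inf K', Sup K')"
        by meson
      moreover have "K \<noteq> K'" using * \<open>i \<noteq> j\<close> by auto
      ultimately have "interior K \<inter> interior K' = {}" using disj by auto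
      moreover have "interior K = {fst i<..<snd i}" "interior K' = {fst j<..<snd j}"
        using K[OF *(1)] K[OF *(2)] *(3,4) interior_atLeastAtMost_real by (metis fst_conv snd_conv)+
      ultimately show "disjnt {fst i<..<snd i} {fst j<..<snd j}" by (simp add: disjnt_def)
    qed
    have finI: "finite I" using fin by (simp add: I_def pN_def)
    have bI: "a \<le> s \<and> s \<le> t \<and> t \<le> b" if st: "(s, t) \<in> I" for s t
    proof -
      obtain x K where "(x, K) \<in> p" "s = Inf K" "t = Sup K"
        using st by (auto simp: I_def pN_def)
      then show ?thesis using K[of x K] by auto
    qed
    have "(\<Sum>(s, t)\<in>I. t - s) < \<delta>"
    proof -
      have "ennreal (\<Sum>(s, t)\<in>I. t - s) = (\<Sum>i\<in>I. emeasure lebesgue {fst i<..<snd i})"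
        using bI by (subst sum_ennreal[symmetric]) (auto simp: case_prod_unfold intro!: sum.cong)
      also have "\<dots> = emeasure lebesgue (\<Union>i\<in>I. {fst i<..<snd i})"
        using pw finI by (intro sum_emeasure) (auto simp: disjoint_family_on_def pairwise_def disjnt_def)
      also have "\<dots> \<le> emeasure lebesgue U"
        using I_open U(1) by (intro emeasure_mono UN_least) (auto simp del: greaterThanLessThan_iff)
      also have "\<dots> < ennreal \<delta>" by (rule emU)
      finally have "ennreal (\<Sum>(s, t)\<in>I. t - s) < ennreal \<delta>" .
      moreover have "0 \<le> (\<Sum>(s, t)\<in>I. t - s)" using bI by (intro sum_nonneg) auto
      ultimately show ?thesis by (simp add: ennreal_less_iff)
    qed
    moreover have "nonoverlapping a b I"
      unfolding nonoverlapping_def using finI pw bI by blast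
    ultimately have "(\<Sum>(s, t)\<in>I. dist (f s) (f t)) < e / 2" by (intro \<delta>)
    moreover have "(\<Sum>(s, t)\<in>I. dist (f s) (f t)) = (\<Sum>(x, K)\<in>pN. norm (f (Sup K) - f (Inf K)))"
      unfolding I_def by (subst sum.reindex[OF inj]) (simp add: case_prod_unfold dist_norm norm_minus_commute)
    ultimately have sumN: "(\<Sum>(x, K)\<in>pN. norm (f (Sup K) - f (Inf K))) < e / 2" by simp
    have good: "norm (measure lborel K *\<^sub>R ?g x - (f (Sup K) - f (Inf K))) \<le> e1 * (Sup K - Inf K)"
      if "(x, K) \<in> p - pN" for x K
    proof -
      have "(x, K) \<in> p" and xN: "x \<notin> N" using that by (auto simp: pN_def)
      from K[OF \<open>(x, K) \<in> p\<close>] obtain u v where k: "K = {u..v}" "u \<le> x" "x \<le> v" "a \<le> u" "v \<le> b" "Inf K = u" "Sup K = v"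
        "{u..v} \<subseteq> ball x (d x)" by blast
      have "norm ((v - u) *\<^sub>R g x - (f v - f u)) = norm (f u - f x - (u - x) *\<^sub>R g x - (f v - f x - (v - x) *\<^sub>R g x))"
        by (auto simp: algebra_simps)
      also have "\<dots> \<le> norm (f u - f x - (u - x) *\<^sub>R g x) + norm (f v - f x - (v - x) *\<^sub>R g x)"
        by (rule norm_triangle_ineq4)
      also have "\<dots> \<le> e1 * norm (u - x) + e1 * norm (v - x)"
      proof -
        have "u \<in> {u..v}" "v \<in> {u..v}" using k(2,3) by auto
        then have "u \<in> ball x (d x)" "v \<in> ball x (d x)" using k(8) by blast+
        then have "norm (u - x) < d x" "norm (v - x) < d x" by (auto simp: dist_norm norm_minus_commute)
        then show ?thesis using k xN by (intro add_mono dG) auto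
      qed
      also have "\<dots> = e1 * (v - u)" using k by (simp add: algebra_simps)
      finally show ?thesis using k xN by simp
    qed
    have "norm ((\<Sum>(x, K)\<in>p. measure lborel K *\<^sub>R ?g x) - (f b - f a))
      = norm (\<Sum>(x, K)\<in>p. measure lborel K *\<^sub>R ?g x - (f (Sup K) - f (Inf K)))"
      by (simp add: ba split_def sum_subtractf)
    also have "\<dots> \<le> (\<Sum>(x, K)\<in>p. norm (measure lborel K *\<^sub>R ?g x - (f (Sup K) - f (Inf K))))"
      unfolding split_def by (rule norm_sum)
    also have "\<dots> = (\<Sum>(x, K)\<in>p - pN. norm (measure lborel K *\<^sub>R ?g x - (f (Sup K) - f (Inf K))))
       + (\<Sum>(x, K)\<in>pN. norm (measure lborel K *\<^sub>R ?g x - (f (Sup K) - f (Inf K))))"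
      using fin by (intro sum.subset_diff) (auto simp: pN_def)
    also have "(\<Sum>(x, K)\<in>pN. norm (measure lborel K *\<^sub>R ?g x - (f (Sup K) - f (Inf K))))
       = (\<Sum>(x, K)\<in>pN. norm (f (Sup K) - f (Inf K)))"
      by (intro sum.cong) (auto simp: pN_def norm_minus_commute)
    also have "(\<Sum>(x, K)\<in>p - pN. norm (measure lborel K *\<^sub>R ?g x - (f (Sup K) - f (Inf K))))
       \<le> (\<Sum>(x, K)\<in>p - pN. e1 * (Sup K - Inf K))"
      using good by (intro sum_mono) auto
    also have "\<dots> \<le> (\<Sum>(x, K)\<in>p. e1 * (Sup K - Inf K))"
    proof (rule sum_mono2[OF fin])
      show "0 \<le> (case xK of (x, K) \<Rightarrow> e1 * (Sup K - Inf K))" if "xK \<in> p - (p - pN)" for xK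
        using K[of "fst xK" "snd xK"] that e1(1) by (cases xK) auto
    qed auto
    also have "\<dots> = e1 * (b - a)" unfolding ba split_def sum_distrib_left by simp
    finally show "norm ((\<Sum>(x, K)\<in>p. measure lborel K *\<^sub>R ?g x) - (f b - f a)) < e"
      using sumN e1(2) by linarith
  qed
qed

text \<open>No measurability is assumed of \<open>m\<close>: the derivative of \<open>f\<close> is measurable, which is
  enough for the lower integral on the right.\<close>
lemma abs_continuous_bound:
  fixes f :: "real \<Rightarrow> real"
  assumes "a \<le> b" and ac: "abs_continuous a b f"
    and der: "AE t in lebesgue_on {a..b}. \<exists>D. (f has_vector_derivative D) (at t within {a..b}) \<and> ennreal \<bar>D\<bar> \<le> m t"
  shows "ennreal \<bar>f b - f a\<bar> \<le> (\<integral>\<^sup>+ t. m t \<partial>lebesgue_on {a..b})"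
proof -
  have "AE t in lebesgue. t \<in> {a..b} \<longrightarrow> (\<exists>D. (f has_vector_derivative D) (at t within {a..b}) \<and> ennreal \<bar>D\<bar> \<le> m t)"
    using der by (subst (asm) AE_restrict_space_iff) auto
  then obtain N where N: "N \<in> null_sets lebesgue" and
    "\<And>t. t \<in> {a..b} - N \<Longrightarrow> \<exists>D. (f has_vector_derivative D) (at t within {a..b}) \<and> ennreal \<bar>D\<bar> \<le> m t"
    by (force elim!: AE_E3)
  then obtain g where g: "\<And>t. t \<in> {a..b} - N \<Longrightarrow> (f has_vector_derivative g t) (at t within {a..b})"
     "\<And>t. t \<in> {a..b} - N \<Longrightarrow> ennreal \<bar>g t\<bar> \<le> m t" by metis
  let ?g = "\<lambda>t. if t \<in> N then 0 else g t"
  have hi: "(?g has_integral (f b - f a)) {a..b}"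
    by (rule abs_continuous_has_integral[OF \<open>a \<le> b\<close> ac N g(1)])
  have meas: "?g \<in> borel_measurable (lebesgue_on {a..b})"
    using has_integral_implies_lebesgue_measurable_cbox[of ?g _ a b] hi by auto
  have le: "(\<integral>\<^sup>+ t. ennreal (norm (?g t)) \<partial>lebesgue_on {a..b}) \<le> (\<integral>\<^sup>+ t. m t \<partial>lebesgue_on {a..b})"
    using g(2) by (intro nn_integral_mono) auto
  show ?thesis
  proof (cases "(\<integral>\<^sup>+ t. m t \<partial>lebesgue_on {a..b}) = \<infinity>")
    case False
    then have int: "integrable (lebesgue_on {a..b}) ?g"
      using le meas by (intro integrableI_bounded) (auto simp: top.not_eq_extremum)
    have "f b - f a = integral\<^sup>L (lebesgue_on {a..b}) ?g"
      using has_integral_integral_lebesgue_on[OF int] hi by (auto intro: has_integral_unique)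
    then show ?thesis using integral_norm_bound_ennreal[OF int] le by (simp)
  qed auto
qed

section \<open>Lower Lebesgue integrals\<close>

text \<open>The lower integral is subadditive over a measurable decomposition of the domain even for a
  nonmeasurable integrand, because the simple functions below it can be decomposed.\<close>
lemma nn_integral_split_le:
  fixes f :: "'a \<Rightarrow> ennreal"
  assumes "A \<in> sets M" "B \<in> sets M" "\<And>x. x \<in> space M \<Longrightarrow> f x \<le> f x * indicator A x + f x * indicator B x"
  shows "(\<integral>\<^sup>+ x. f x \<partial>M) \<le> (\<integral>\<^sup>+ x. f x * indicator A x \<partial>M) + (\<integral>\<^sup>+ x. f x * indicator B x \<partial>M)"
proof -
  have "integral\<^sup>S M g \<le> (\<integral>\<^sup>+ x. f x * indicator A x \<partial>M) + (\<integral>\<^sup>+ x. f x * indicator B x \<partial>M)"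
    if g: "simple_function M g" "g \<le> f" for g
  proof -
    have gf: "g x \<le> f x" for x using g(2) by (auto simp: le_fun_def)
    note gm[measurable] = borel_measurable_simple_function[OF g(1)]
    note [measurable] = assms(1,2)
    have "g x \<le> g x * indicator A x + g x * indicator B x" if "x \<in> space M" for x
      using assms(3)[OF that] gf[of x] by (auto split: split_indicator split_indicator_asm)
    then have "(\<integral>\<^sup>+ x. g x \<partial>M) \<le> (\<integral>\<^sup>+ x. g x * indicator A x + g x * indicator B x \<partial>M)"
      by (intro nn_integral_mono)
    also have "\<dots> = (\<integral>\<^sup>+ x. g x * indicator A x \<partial>M) + (\<integral>\<^sup>+ x. g x * indicator B x \<partial>M)"
      by (intro nn_integral_add) auto
    also have "\<dots> \<le> (\<integral>\<^sup>+ x. f x * indicator A x \<partial>M) + (\<integral>\<^sup>+ x. f x * indicator B x \<partial>M)"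
      by (intro add_mono nn_integral_mono mult_right_mono gf) auto
    finally show ?thesis using nn_integral_eq_simple_integral[OF g(1)] by simp
  qed
  then show ?thesis unfolding nn_integral_def[of M f] by (intro SUP_least) auto
qed

lemma reflect_measurable_lebesgue: "(\<lambda>t::real. k - t) \<in> lebesgue \<rightarrow>\<^sub>M lebesgue"
  using lebesgue_affine_measurable[where c="\<lambda>_::real. -1" and t=k] by simp

lemma lebesgue_reflect: "distr lebesgue lebesgue (\<lambda>t::real. k - t) = lebesgue"
  using lebesgue_real_affine[of "-1" k] by (simp add: density_1)

text \<open>Here too \<open>f\<close> need not be measurable: it suffices to reflect the simple functions below.\<close>
lemma nn_integral_reflect_le:
  fixes f :: "real \<Rightarrow> ennreal"
  shows "(\<integral>\<^sup>+ t. f (k - t) \<partial>lebesgue) \<le> (\<integral>\<^sup>+ t. f t \<partial>lebesgue)"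
proof -
  have "integral\<^sup>S lebesgue g \<le> (\<integral>\<^sup>+ t. f t \<partial>lebesgue)"
    if g: "simple_function lebesgue g" "g \<le> (\<lambda>t. f (k - t))" for g
  proof -
    have gf: "g (k - t) \<le> f t" for t using g(2) by (force simp: le_fun_def dest: spec[of _ "k - t"])
    note gm = borel_measurable_simple_function[OF g(1)]
    have "(\<integral>\<^sup>+ t. g t \<partial>lebesgue) = (\<integral>\<^sup>+ t. g t \<partial>distr lebesgue lebesgue (\<lambda>t. k - t))"
      by (simp add: lebesgue_reflect)
    also have "\<dots> = (\<integral>\<^sup>+ t. g (k - t) \<partial>lebesgue)"
      using gm by (intro nn_integral_distr reflect_measurable_lebesgue) (simp add: lebesgue_reflect)
    also have "\<dots> \<le> (\<integral>\<^sup>+ t. f t \<partial>lebesgue)" by (intro nn_integral_mono gf)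
    finally show ?thesis using nn_integral_eq_simple_integral[OF g(1)] by simp
  qed
  then show ?thesis unfolding nn_integral_def[of lebesgue "\<lambda>t. f (k - t)"] by (intro SUP_least) auto
qed

lemma AE_reflect_lebesgue:
  assumes "AE t in lebesgue. P t"
  shows "AE t in lebesgue. P (k - t :: real)"
  using AE_distrD[OF reflect_measurable_lebesgue[of k], of P] assms unfolding lebesgue_reflect by simp

section \<open>Peano's existence theorem\<close>

text \<open>Picard iteration for the delayed equation \<open>x(t) = q + \<integral>\<^sub>0\<^sup>t F(x(s - h)) ds\<close>, where \<open>x\<close> is
  extended by its value at \<open>0\<close> to negative times. The delay makes the iteration stationary: the step
  from \<open>j\<close> to \<open>j + 1\<close> changes nothing on \<open>[0, j h]\<close> (\<open>tonelli_stable\<close> below).\<close>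
primrec tonelli :: "('b::euclidean_space \<Rightarrow> 'b) \<Rightarrow> 'b \<Rightarrow> real \<Rightarrow> nat \<Rightarrow> real \<Rightarrow> 'b" where
  "tonelli F q h 0 = (\<lambda>t. q)"
| "tonelli F q h (Suc j) = (\<lambda>t. q + integral {0..t} (\<lambda>s. F (tonelli F q h j (max 0 (s - h)))))"

lemma integral_bounded_lipschitz:
  fixes g :: "real \<Rightarrow> 'b::euclidean_space"
  assumes "continuous_on {0..} g" "\<And>s. norm (g s) \<le> C" "0 \<le> s" "s \<le> t"
  shows "norm (integral {0..t} g - integral {0..s} g) \<le> C * (t - s)"
proof -
  have int: "g integrable_on {0..t}"
    using assms by (intro integrable_continuous_real) (auto intro: continuous_on_subset)
  have "integral {0..s} g + integral {s..t} g = integral {0..t} g"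
    using assms int by (intro Henstock_Kurzweil_Integration.integral_combine) auto
  then have "norm (integral {0..t} g - integral {0..s} g) = norm (integral {s..t} g)"
    by (metis add_diff_cancel_left')
  also have "\<dots> \<le> C * (t - s)"
    using assms by (intro integral_bound) (auto intro: continuous_on_subset)
  finally show ?thesis .
qed

lemma lipschitz_delayed_continuous:
  fixes z :: "real \<Rightarrow> 'b::euclidean_space"
  assumes "\<And>s t. 0 \<le> s \<Longrightarrow> s \<le> t \<Longrightarrow> norm (z t - z s) \<le> C * (t - s)"
  shows "continuous_on S (\<lambda>s. z (max 0 (s - h)))"
proof -
  have "dist (z t) (z s) \<le> C * dist t s" if "0 \<le> s" "0 \<le> t" for s t
    using assms[of s t] assms[of t s] that
    by (cases "s \<le> t") (auto simp: dist_norm norm_minus_commute abs_if)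
  moreover have "C \<ge> 0" using assms[of 0 1] norm_ge_zero[of "z 1 - z 0"] by (simp del: norm_ge_zero)
  ultimately have "C-lipschitz_on {0..} z" by (intro lipschitz_onI) auto
  then have "continuous_on {0..} z" by (rule lipschitz_on_continuous_on)
  then show ?thesis
    by (rule continuous_on_compose2) (auto intro!: continuous_intros)
qed

context
  fixes F :: "'b::euclidean_space \<Rightarrow> 'b" and C :: real
  assumes cont: "continuous_on UNIV F" and bound: "\<And>z. norm (F z) \<le> C"
begin

lemma tonelli_lipschitz:
  "0 \<le> s \<Longrightarrow> s \<le> t \<Longrightarrow> norm (tonelli F q h j t - tonelli F q h j s) \<le> C * (t - s)"
proof (induction j arbitrary: s t)
  case 0
  have "0 \<le> C" using bound[of 0] norm_ge_zero[of "F 0"] by linarith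
  then show ?case using 0 by simp
next
  case (Suc j)
  have "continuous_on {0..} (\<lambda>s. F (tonelli F q h j (max 0 (s - h))))"
    by (rule continuous_on_compose2[OF cont lipschitz_delayed_continuous[OF Suc.IH]]) auto
  from integral_bounded_lipschitz[OF this bound Suc.prems] show ?case by simp
qed

lemma tonelli_stable:
  "0 \<le> t \<Longrightarrow> t \<le> real j * h \<Longrightarrow> tonelli F q h (Suc j) t = tonelli F q h j t"
proof (induction j arbitrary: t)
  case (Suc j)
  have "integral {0..t} (\<lambda>s. F (tonelli F q h (Suc j) (max 0 (s - h))))
      = integral {0..t} (\<lambda>s. F (tonelli F q h j (max 0 (s - h))))"
  proof (rule Henstock_Kurzweil_Integration.integral_cong)
    fix s assume "s \<in> {0..t}"
    moreover have "0 \<le> real j * h"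
    proof -
      have "0 \<le> real (Suc j) * h" using Suc.prems by linarith
      then show ?thesis by (simp add: zero_le_mult_iff)
    qed
    ultimately have "tonelli F q h (Suc j) (max 0 (s - h)) = tonelli F q h j (max 0 (s - h))"
      using Suc.prems by (intro Suc.IH) (auto simp: algebra_simps)
    then show "F (tonelli F q h (Suc j) (max 0 (s - h))) = F (tonelli F q h j (max 0 (s - h)))" by simp
  qed
  then show ?case by (simp del: tonelli.simps(2) add: tonelli.simps(2)[of F q h "Suc j"] tonelli.simps(2)[of F q h j])
qed simp

text \<open>Peano's theorem for a bounded continuous field: exact solutions of the equations with delay
  \<open>1 / (n + 1)\<close> are uniformly Lipschitz, so a subsequence converges uniformly, and the limit solves the
  equation without delay.\<close>
theorem peano_existence:
  assumes "T \<ge> 0"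
  obtains x where "x 0 = q"
    "\<And>t. t \<in> {0..T} \<Longrightarrow> (x has_vector_derivative F (x t)) (at t within {0..T})"
proof -
  have C: "0 \<le> C" using bound[of 0] norm_ge_zero[of "F 0"] by linarith
  define h where "h n = 1 / real (Suc n)" for n
  define J where "J n = nat \<lceil>T * real (Suc n)\<rceil>" for n
  define X where "X n = tonelli F q (h n) (J n)" for n
  have Tle: "T \<le> real (J n) * h n" for n
  proof -
    have "T * real (Suc n) \<le> real (J n)" unfolding J_def by linarith
    then show ?thesis by (simp add: h_def field_simps)
  qed
  have lip: "norm (X n t - X n s) \<le> C * (t - s)" if "0 \<le> s" "s \<le> t" for n s t
    unfolding X_def using that by (rule tonelli_lipschitz)
  have lip': "norm (X n t - X n s) \<le> C * \<bar>t - s\<bar>" if "0 \<le> s" "0 \<le> t" for n s t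
    using lip[of s t n] lip[of t s n] that by (cases "s \<le> t") (auto simp: norm_minus_commute)
  have eq: "X n t = q + integral {0..t} (\<lambda>s. F (X n (max 0 (s - h n))))" if "t \<in> {0..T}" for n t
  proof -
    have "X n t = tonelli F q (h n) (Suc (J n)) t"
      unfolding X_def using that Tle[of n] by (intro tonelli_stable[symmetric]) auto
    then show ?thesis by (simp add: X_def)
  qed
  have X0: "X n 0 = q" for n using eq[of 0 n] assms by simp
  have "\<exists>d>0. \<forall>n y. y \<in> {0..T} \<and> norm (x - y) < d \<longrightarrow> norm (X n x - X n y) < e"
    if "x \<in> {0..T}" "e > 0" for x e
  proof (intro exI conjI allI impI)
    show "0 < e / (C + 1)" using that C by simp
    fix n y assume y: "y \<in> {0..T} \<and> norm (x - y) < e / (C + 1)"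
    have "norm (X n x - X n y) \<le> C * \<bar>x - y\<bar>" using lip'[of y x n] that y by auto
    also have "\<dots> \<le> (C + 1) * \<bar>x - y\<bar>" by (simp add: mult_right_mono)
    also have "\<dots> < e" using y C by (simp add: field_simps)
    finally show "norm (X n x - X n y) < e" .
  qed
  moreover have "norm (X n x) \<le> norm q + C * T" if "x \<in> {0..T}" for n x
  proof -
    have "norm (X n x) \<le> norm (X n 0) + norm (X n x - X n 0)" by (rule norm_triangle_sub)
    also have "\<dots> \<le> norm q + C * x" using lip[of 0 x n] that X0 by auto
    also have "\<dots> \<le> norm q + C * T" using that C by (auto intro: mult_left_mono)
    finally show ?thesis .
  qed
  ultimately obtain g k where g: "continuous_on {0..T} g" and k: "strict_mono (k :: nat \<Rightarrow> nat)"
    and unif: "\<And>e. 0 < e \<Longrightarrow> \<exists>N. \<forall>n x. n \<ge> N \<and> x \<in> {0..T} \<longrightarrow> norm(X (k n) x - g x) < e"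
    using Arzela_Ascoli[of "{0..T}" X "norm q + C * T"] by (metis compact_Icc)
  have lim: "(\<lambda>n. X (k n) t) \<longlonglongrightarrow> g t" if "t \<in> {0..T}" for t
    unfolding LIMSEQ_iff using unif that by meson
  have hk: "(\<lambda>n. h (k n)) \<longlonglongrightarrow> 0"
  proof -
    have "h \<longlonglongrightarrow> 0" unfolding h_def by (rule LIMSEQ_Suc[OF lim_1_over_n])
    from LIMSEQ_subseq_LIMSEQ[OF this k] show ?thesis by (simp add: comp_def)
  qed
  have limd: "(\<lambda>n. X (k n) (max 0 (s - h (k n)))) \<longlonglongrightarrow> g s" if "s \<in> {0..T}" for s
  proof -
    have "(\<lambda>n. X (k n) (max 0 (s - h (k n))) - X (k n) s) \<longlonglongrightarrow> 0"
    proof (rule Lim_null_comparison)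
      show "\<forall>\<^sub>F n in sequentially. norm (X (k n) (max 0 (s - h (k n))) - X (k n) s) \<le> C * h (k n)"
      proof (rule always_eventually, rule allI)
        fix n
        have "h (k n) \<ge> 0" by (simp add: h_def)
        then have "\<bar>max 0 (s - h (k n)) - s\<bar> \<le> h (k n)" using that by auto
        then show "norm (X (k n) (max 0 (s - h (k n))) - X (k n) s) \<le> C * h (k n)"
          using lip'[of s "max 0 (s - h (k n))" "k n"] that mult_left_mono[OF _ C] by fastforce
      qed
      show "(\<lambda>n. C * h (k n)) \<longlonglongrightarrow> 0" using tendsto_mult_left[OF hk, of C] by simp
    qed
    from tendsto_add[OF this lim[OF that]] show ?thesis by simp
  qed
  have geq: "g t = q + integral {0..t} (\<lambda>s. F (g s))" if t: "t \<in> {0..T}" for t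
  proof -
    have "(\<lambda>n. integral {0..t} (\<lambda>s. F (X (k n) (max 0 (s - h (k n)))))) \<longlonglongrightarrow> integral {0..t} (\<lambda>s. F (g s))"
    proof (rule dominated_convergence(2))
      show "(\<lambda>s. F (X (k n) (max 0 (s - h (k n))))) integrable_on {0..t}" for n
        by (intro integrable_continuous_real continuous_on_compose2[OF cont lipschitz_delayed_continuous[OF lip]]) auto
      show "(\<lambda>s. C) integrable_on {0..t}" by auto
      show "(\<lambda>n. F (X (k n) (max 0 (s - h (k n))))) \<longlonglongrightarrow> F (g s)" if "s \<in> {0..t}" for s
        using that t by (intro continuous_on_tendsto_compose[OF cont limd]) auto
    qed (use bound in auto)
    then have "(\<lambda>n. X (k n) t) \<longlonglongrightarrow> q + integral {0..t} (\<lambda>s. F (g s))"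
      unfolding eq[OF t] by (intro tendsto_intros)
    then show ?thesis using LIMSEQ_unique lim[OF t] by blast
  qed
  show thesis
  proof
    show "g 0 = q" using geq[of 0] assms by simp
    fix t assume t: "t \<in> {0..T}"
    have "continuous_on {0..T} (\<lambda>s. F (g s))" by (rule continuous_on_compose2[OF cont g]) auto
    from integral_has_vector_derivative[OF this t]
    have "((\<lambda>u. q + integral {0..u} (\<lambda>s. F (g s))) has_vector_derivative F (g t)) (at t within {0..T})"
      by (auto intro!: derivative_eq_intros)
    from has_vector_derivative_transform[OF t geq this]
    show "(g has_vector_derivative F (g t)) (at t within {0..T})" by simp
  qed
qed

end

section \<open>Controls and lengths of admissible curves\<close>

lemma has_velocity_unique:
  assumes "a < b" "t \<in> {a..b}" "has_velocity A \<gamma> a b t v" "has_velocity A \<gamma> a b t v'"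
    and "c \<in> A" "\<gamma> t \<in> chart_dom c"
  shows "v c = v' c"
  using assms unfolding has_velocity_def
  by (intro vector_derivative_unique_within_closed_interval[of a b t "chart_map c \<circ> \<gamma>"]) auto

text \<open>The admissible controls at a time form a closed set, so the minimum defining \<open>min_control\<close> is
  attained as soon as there is some control.\<close>
lemma min_control_in_controls:
  fixes u :: "real ^ 'm::finite"
  assumes "a < b" "t \<in> {a..b}" "u \<in> controls A X a b \<gamma> t"
  shows "min_control A X a b \<gamma> t \<in> controls A X a b \<gamma> t"
    and "norm (min_control A X a b \<gamma> t) \<le> norm u"
proof -
  let ?C = "controls A X a b \<gamma> t"
  let ?v = "\<lambda>(u::real^'m) c. \<Sum>j\<in>UNIV. (u $ j) *\<^sub>R X j (\<gamma> t) c"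
  have eq: "?C = (\<Inter>c\<in>{c \<in> A. \<gamma> t \<in> chart_dom c}. {u'. ?v u' c = ?v u c})"
  proof (intro set_eqI iffI)
    fix u' assume "u' \<in> ?C"
    then show "u' \<in> (\<Inter>c\<in>{c \<in> A. \<gamma> t \<in> chart_dom c}. {u'. ?v u' c = ?v u c})"
      using has_velocity_unique[OF assms(1,2), of A \<gamma> "?v u'" "?v u"] assms(3)
      by (auto simp: controls_def)
  next
    fix u' assume "u' \<in> (\<Inter>c\<in>{c \<in> A. \<gamma> t \<in> chart_dom c}. {u'. ?v u' c = ?v u c})"
    then show "u' \<in> ?C" using assms(3) by (auto simp: controls_def has_velocity_def)
  qed
  have "closed ?C" unfolding eq
    by (intro closed_INT ballI closed_Collect_eq continuous_intros)
  then obtain u0 where u0: "u0 \<in> ?C" "\<And>y. y \<in> ?C \<Longrightarrow> dist 0 u0 \<le> dist 0 y"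
    using distance_attains_inf[of ?C 0] assms(3) by blast
  have mc: "min_control A X a b \<gamma> t \<in> ?C \<and> (\<forall>y\<in>?C. norm (min_control A X a b \<gamma> t) \<le> norm y)"
    unfolding min_control_def
    by (rule arg_minI[where x=u0]) (use u0 in \<open>auto simp: not_less\<close>)
  show "min_control A X a b \<gamma> t \<in> ?C" using mc by (rule conjunct1)
  show "norm (min_control A X a b \<gamma> t) \<le> norm u" using mc assms(3) by simp
qed

lemma admissible_AE_min_control:
  assumes "admissible A X a b \<gamma> p q"
  shows "AE t in lebesgue_on {a..b}. min_control A X a b \<gamma> t \<in> controls A X a b \<gamma> t"
proof -
  obtain h where h: "AE t in lebesgue_on {a..b}. h t \<in> controls A X a b \<gamma> t" and "a < b"
    using assms unfolding admissible_def by blast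
  from h AE_space[of "lebesgue_on {a..b}"] show ?thesis
  proof eventually_elim
    case (elim t)
    then show ?case using min_control_in_controls(1)[OF \<open>a < b\<close>, of t "h t" A X \<gamma>] by simp
  qed
qed

lemma CC_length_lebesgue:
  "CC_length A X a b \<gamma> = (\<integral>\<^sup>+ t. ennreal (norm (min_control A X a b \<gamma> t)) * indicator {a..b} t \<partial>lebesgue)"
  unfolding CC_length_def by (rule nn_integral_restrict_space) simp

lemma AE_lebesgue_on_Icc:
  "(AE t in lebesgue_on {a..b::real}. P t) \<longleftrightarrow> (AE t in lebesgue. t \<in> {a..b} \<longrightarrow> P t)"
  by (rule AE_restrict_space_iff) simp

lemma has_velocity_reflect:
  assumes "has_velocity A \<gamma> a b (k - t) v"
  shows "has_velocity A (\<lambda>t. \<gamma> (k - t)) (k - b) (k - a) t (\<lambda>c. - v c)"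
  unfolding has_velocity_def
proof (intro ballI impI)
  fix c assume "c \<in> A" "\<gamma> (k - t) \<in> chart_dom c"
  then have "((chart_map c \<circ> \<gamma>) has_vector_derivative v c) (at (k - t) within {a..b})"
    using assms by (auto simp: has_velocity_def)
  moreover have "(\<lambda>t. k - t) ` {k - b..k - a} = {a..b}" by simp
  moreover have "((\<lambda>t. k - t) has_vector_derivative - 1) (at t within {k - b..k - a})"
    by (auto intro!: derivative_eq_intros)
  ultimately have "((chart_map c \<circ> \<gamma> \<circ> (\<lambda>t. k - t)) has_vector_derivative - 1 *\<^sub>R v c) (at t within {k - b..k - a})"
    by (intro vector_diff_chain_within) auto
  then show "((chart_map c \<circ> (\<lambda>t. \<gamma> (k - t))) has_vector_derivative - v c) (at t within {k - b..k - a})"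
    by (simp add: comp_def)
qed

lemma controls_reflect:
  assumes "u \<in> controls A X a b \<gamma> (k - t)"
  shows "- u \<in> controls A X (k - b) (k - a) (\<lambda>t. \<gamma> (k - t)) t"
  using has_velocity_reflect[of A \<gamma> a b k t "\<lambda>c. \<Sum>j\<in>UNIV. (u $ j) *\<^sub>R X j (\<gamma> (k - t)) c"] assms
  by (simp add: controls_def sum_negf)

lemma abs_continuous_curve_reflect:
  assumes "abs_continuous_curve A a b \<gamma>"
  shows "abs_continuous_curve A (k - b) (k - a) (\<lambda>t. \<gamma> (k - t))"
  unfolding abs_continuous_curve_def
proof (intro conjI ballI allI impI)
  have "continuous_on {a..b} \<gamma>" using assms by (auto simp: abs_continuous_curve_def)
  then show "continuous_on {k - b..k - a} (\<lambda>t. \<gamma> (k - t))"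
    by (rule continuous_on_compose2) (auto intro!: continuous_intros)
next
  fix c s t assume c: "c \<in> A" and st: "k - b \<le> s \<and> s \<le> t \<and> t \<le> k - a \<and> (\<lambda>t. \<gamma> (k - t)) ` {s..t} \<subseteq> chart_dom c"
  have "\<gamma> r \<in> chart_dom c" if "r \<in> {k - t..k - s}" for r
  proof -
    have "k - r \<in> {s..t}" using that by auto
    then have "\<gamma> (k - (k - r)) \<in> chart_dom c" using st by blast
    then show ?thesis by simp
  qed
  then have "\<gamma> ` {k - t..k - s} \<subseteq> chart_dom c" by blast
  then have "abs_continuous (k - t) (k - s) (chart_map c \<circ> \<gamma>)"
    using assms c st unfolding abs_continuous_curve_def by (auto simp: algebra_simps)
  from abs_continuous_reflect[OF this]
  show "abs_continuous s t (chart_map c \<circ> (\<lambda>t. \<gamma> (k - t)))" by (simp add: comp_def)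
qed

lemma admissible_reflect:
  fixes X :: "'m::finite \<Rightarrow> 'a::topological_space \<Rightarrow> ('a, 'n::finite) tvec"
  assumes adm: "admissible A X a b \<gamma> p q"
  shows "admissible A X (k - b) (k - a) (\<lambda>t. \<gamma> (k - t)) q p"
    and "CC_length A X (k - b) (k - a) (\<lambda>t. \<gamma> (k - t)) \<le> CC_length A X a b \<gamma>"
proof -
  obtain h :: "real \<Rightarrow> real ^ 'm" where "a < b" and ac: "abs_continuous_curve A a b \<gamma>" and "\<gamma> a = p" "\<gamma> b = q"
    and hm: "h \<in> borel_measurable (lebesgue_on {a..b})"
    and h: "AE t in lebesgue_on {a..b}. h t \<in> controls A X a b \<gamma> t"
    using adm unfolding admissible_def by blast
  have meas: "(\<lambda>t. k - t) \<in> lebesgue_on {k - b..k - a} \<rightarrow>\<^sub>M lebesgue_on {a..b}"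
    by (rule measurable_restrict_space3[OF reflect_measurable_lebesgue]) auto
  have "(\<lambda>t. - h (k - t)) \<in> borel_measurable (lebesgue_on {k - b..k - a})"
    using measurable_compose[OF meas hm] by simp
  moreover have "AE t in lebesgue_on {k - b..k - a}. - h (k - t) \<in> controls A X (k - b) (k - a) (\<lambda>t. \<gamma> (k - t)) t"
    using AE_reflect_lebesgue[OF h[unfolded AE_lebesgue_on_Icc], of k] unfolding AE_lebesgue_on_Icc
    by eventually_elim (auto intro!: controls_reflect)
  ultimately show "admissible A X (k - b) (k - a) (\<lambda>t. \<gamma> (k - t)) q p"
    using \<open>a < b\<close> \<open>\<gamma> a = p\<close> \<open>\<gamma> b = q\<close> abs_continuous_curve_reflect[OF ac, of k]
    unfolding admissible_def by (intro conjI exI[of _ "\<lambda>t. - h (k - t)"]) auto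
  define G where "G t = ennreal (norm (min_control A X a b \<gamma> t)) * indicator {a..b} t" for t
  have le: "norm (min_control A X (k - b) (k - a) (\<lambda>t. \<gamma> (k - t)) t) \<le> norm (min_control A X a b \<gamma> (k - t))"
    if "k - t \<in> {a..b}" "min_control A X a b \<gamma> (k - t) \<in> controls A X a b \<gamma> (k - t)" for t
    using min_control_in_controls(2)[OF _ _ controls_reflect[OF that(2)]] that(1) \<open>a < b\<close> by auto
  have "CC_length A X (k - b) (k - a) (\<lambda>t. \<gamma> (k - t)) \<le> (\<integral>\<^sup>+ t. G (k - t) \<partial>lebesgue)"
    unfolding CC_length_lebesgue
  proof (rule nn_integral_mono_AE)
    show "AE t in lebesgue. ennreal (norm (min_control A X (k - b) (k - a) (\<lambda>t. \<gamma> (k - t)) t)) * indicator {k - b..k - a} t \<le> G (k - t)"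
      using AE_reflect_lebesgue[OF admissible_AE_min_control[OF adm, unfolded AE_lebesgue_on_Icc], of k]
    proof eventually_elim
      case (elim t)
      show ?case
      proof (cases "k - t \<in> {a..b}")
        case True
        then show ?thesis using le[OF True] elim by (auto simp: G_def ennreal_leI split: split_indicator)
      next
        case False
        then have "t \<notin> {k - b..k - a}" by auto
        then show ?thesis by simp
      qed
    qed
  qed
  also have "\<dots> \<le> (\<integral>\<^sup>+ t. G t \<partial>lebesgue)" by (rule nn_integral_reflect_le)
  also have "\<dots> = CC_length A X a b \<gamma>" by (simp add: CC_length_lebesgue G_def)
  finally show "CC_length A X (k - b) (k - a) (\<lambda>t. \<gamma> (k - t)) \<le> CC_length A X a b \<gamma>" .
qed

text \<open>A control of \<open>\<gamma>\<close> at \<open>t\<close> is also one of a curve \<open>\<gamma>'\<close> that agrees with \<open>\<gamma>\<close> on \<open>[a,b]\<close>, provided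
  that the two parameter intervals agree in a neighbourhood \<open>U\<close> of \<open>t\<close>.\<close>
lemma controls_restrict:
  assumes "u \<in> controls A X a b \<gamma> t" "\<And>s. s \<in> {a..b} \<Longrightarrow> \<gamma>' s = \<gamma> s"
    and "t \<in> {a..b}" "open U" "t \<in> U" "{a..b} \<inter> U = {a'..b'} \<inter> U"
  shows "u \<in> controls A X a' b' \<gamma>' t"
  unfolding controls_def has_velocity_def mem_Collect_eq
proof (intro ballI impI)
  fix c assume "c \<in> A" "\<gamma>' t \<in> chart_dom c"
  then have "((chart_map c \<circ> \<gamma>) has_vector_derivative (\<Sum>j\<in>UNIV. (u $ j) *\<^sub>R X j (\<gamma> t) c)) (at t within {a..b})"
    using assms(1-3) by (auto simp: controls_def has_velocity_def)
  then have "((chart_map c \<circ> \<gamma>') has_vector_derivative (\<Sum>j\<in>UNIV. (u $ j) *\<^sub>R X j (\<gamma> t) c)) (at t within {a..b})"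
    by (rule has_vector_derivative_transform[rotated 2]) (use assms(2,3) in auto)
  moreover have "at t within {a..b} = at t within {a'..b'}"
    using assms(4-6) by (intro at_within_nhd[of t U]) auto
  ultimately show "((chart_map c \<circ> \<gamma>') has_vector_derivative (\<Sum>j\<in>UNIV. (u $ j) *\<^sub>R X j (\<gamma>' t) c)) (at t within {a'..b'})"
    using assms(2,3) by simp
qed

lemma abs_continuous_cong:
  assumes "abs_continuous a b f" "\<And>t. t \<in> {a..b} \<Longrightarrow> g t = f t"
  shows "abs_continuous a b g"
  by (rule abs_continuousI_dist_le[OF assms(1), of 1]) (use assms(2) in auto)

lemma continuous_on_chart_map:
  "is_chart c \<Longrightarrow> continuous_on (chart_dom c) (chart_map c)"
  unfolding is_chart_def homeomorphism_def by blast

lemma abs_continuous_curve_concat: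
  assumes charts: "\<And>c. c \<in> A \<Longrightarrow> is_chart c"
    and 1: "abs_continuous_curve A a b \<gamma>1" and 2: "abs_continuous_curve A b d \<gamma>2"
    and eq: "\<gamma>1 b = \<gamma>2 b" and ab: "a \<le> b" "b \<le> d"
  shows "abs_continuous_curve A a d (\<lambda>t. if t \<le> b then \<gamma>1 t else \<gamma>2 t)"
proof -
  let ?\<gamma> = "\<lambda>t. if t \<le> b then \<gamma>1 t else \<gamma>2 t"
  have g1: "?\<gamma> t = \<gamma>1 t" if "t \<in> {a..b}" for t using that by auto
  have g2: "?\<gamma> t = \<gamma>2 t" if "t \<in> {b..d}" for t using that eq by auto
  have "continuous_on ({a..b} \<union> {b..d}) ?\<gamma>"
  proof (rule continuous_on_closed_Un)
    show "continuous_on {a..b} ?\<gamma>"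
      using 1 g1 by (subst continuous_on_cong[OF refl, of _ _ \<gamma>1]) (auto simp: abs_continuous_curve_def)
    show "continuous_on {b..d} ?\<gamma>"
      using 2 g2 by (subst continuous_on_cong[OF refl, of _ _ \<gamma>2]) (auto simp: abs_continuous_curve_def)
  qed auto
  then have cont: "continuous_on {a..d} ?\<gamma>" using ab by (simp add: ivl_disj_un)
  show ?thesis
    unfolding abs_continuous_curve_def
  proof (intro conjI ballI allI impI cont)
    fix c s t assume c: "c \<in> A" and st: "a \<le> s \<and> s \<le> t \<and> t \<le> d \<and> ?\<gamma> ` {s..t} \<subseteq> chart_dom c"
    have L: "abs_continuous s t' (chart_map c \<circ> ?\<gamma>)" if t': "s \<le> t'" "t' \<le> b" "t' \<le> t" for t'
    proof (rule abs_continuous_cong)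
      have "\<gamma>1 r \<in> chart_dom c" if "r \<in> {s..t'}" for r
      proof -
        have "?\<gamma> r \<in> chart_dom c" using st t' that by force
        then show ?thesis using that t' by simp
      qed
      then have "\<gamma>1 ` {s..t'} \<subseteq> chart_dom c" by blast
      then show "abs_continuous s t' (chart_map c \<circ> \<gamma>1)"
        using 1 c st t' unfolding abs_continuous_curve_def by blast
    qed (use t' in auto)
    have R: "abs_continuous s' t (chart_map c \<circ> ?\<gamma>)" if s': "s \<le> s'" "b \<le> s'" "s' \<le> t" for s'
    proof (rule abs_continuous_cong)
      have "\<gamma>2 r \<in> chart_dom c" if "r \<in> {s'..t}" for r
      proof -
        have "?\<gamma> r \<in> chart_dom c" using st s' that by force
        moreover have "r \<in> {b..d}" using that s' st by auto
        ultimately show ?thesis using g2 by metis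
      qed
      then have "\<gamma>2 ` {s'..t} \<subseteq> chart_dom c" by blast
      then show "abs_continuous s' t (chart_map c \<circ> \<gamma>2)"
        using 2 c st s' unfolding abs_continuous_curve_def by blast
      show "(chart_map c \<circ> ?\<gamma>) r = (chart_map c \<circ> \<gamma>2) r" if "r \<in> {s'..t}" for r
        using that s' st g2[of r] by auto
    qed
    consider "t \<le> b" | "b \<le> s" | "s \<le> b" "b \<le> t" using st by linarith
    then show "abs_continuous s t (chart_map c \<circ> ?\<gamma>)"
    proof cases
      case 1 then show ?thesis using L[of t] st by simp
    next
      case 2 then show ?thesis using R[of s] st by simp
    next
      case 3
      have "continuous_on {s..t} ?\<gamma>" using st by (intro continuous_on_subset[OF cont]) auto
      then have co: "continuous_on {s..t} (chart_map c \<circ> ?\<gamma>)"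
        using st continuous_on_subset[OF continuous_on_chart_map[OF charts[OF c]]]
        by (intro continuous_on_compose) auto
      show ?thesis
        by (rule abs_continuous_concat[OF L[of b] R[of b] co]) (use 3 in auto)
    qed
  qed
qed

lemma admissible_concat:
  fixes X :: "'m::finite \<Rightarrow> 'a::topological_space \<Rightarrow> ('a, 'n::finite) tvec"
  assumes charts: "\<And>c. c \<in> A \<Longrightarrow> is_chart c"
    and adm1: "admissible A X a b \<gamma>1 p q" and adm2: "admissible A X b d \<gamma>2 q r"
  defines "\<gamma> \<equiv> \<lambda>t. if t \<le> b then \<gamma>1 t else \<gamma>2 t"
  shows "admissible A X a d \<gamma> p r"
    and "CC_length A X a d \<gamma> \<le> CC_length A X a b \<gamma>1 + CC_length A X b d \<gamma>2"
proof -
  obtain h1 :: "real \<Rightarrow> real ^ 'm" where "a < b" and ac1: "abs_continuous_curve A a b \<gamma>1" and "\<gamma>1 a = p" "\<gamma>1 b = q"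
    and hm1: "h1 \<in> borel_measurable (lebesgue_on {a..b})"
    and h1: "AE t in lebesgue_on {a..b}. h1 t \<in> controls A X a b \<gamma>1 t"
    using adm1 unfolding admissible_def by blast
  obtain h2 :: "real \<Rightarrow> real ^ 'm" where "b < d" and ac2: "abs_continuous_curve A b d \<gamma>2" and "\<gamma>2 b = q" "\<gamma>2 d = r"
    and hm2: "h2 \<in> borel_measurable (lebesgue_on {b..d})"
    and h2: "AE t in lebesgue_on {b..d}. h2 t \<in> controls A X b d \<gamma>2 t"
    using adm2 unfolding admissible_def by blast
  have g2: "\<gamma> t = \<gamma>2 t" if "t \<in> {b..d}" for t
    using that \<open>\<gamma>1 b = q\<close> \<open>\<gamma>2 b = q\<close> by (auto simp: \<gamma>_def)
  have c1: "u \<in> controls A X a d \<gamma> t" if "u \<in> controls A X a b \<gamma>1 t" "t \<in> {a..<b}" for u t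
    by (rule controls_restrict[OF that(1), where U="{..<b}"]) (use that \<open>b < d\<close> in \<open>auto simp: \<gamma>_def\<close>)
  have c2: "u \<in> controls A X a d \<gamma> t" if "u \<in> controls A X b d \<gamma>2 t" "t \<in> {b<..d}" for u t
    by (rule controls_restrict[OF that(1), where U="{b<..}"]) (use that \<open>a < b\<close> g2 in auto)
  have AEb: "AE t in lebesgue. t \<noteq> b"
    using AE_lborel_singleton[of b] by (rule AE_completion)
  define h where "h t = (if t < b then h1 t else h2 t)" for t
  have "(\<lambda>t. indicator {a..d} t *\<^sub>R h t) = (\<lambda>t. if t < b then indicator {a..b} t *\<^sub>R h1 t else indicator {b..d} t *\<^sub>R h2 t)"
    using \<open>a < b\<close> \<open>b < d\<close> by (auto simp: h_def fun_eq_iff split: split_indicator)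
  moreover have "(\<lambda>t. if t < b then indicator {a..b} t *\<^sub>R h1 t else indicator {b..d} t *\<^sub>R h2 t) \<in> borel_measurable lebesgue"
    using hm1 hm2 by (intro measurable_If) (auto simp: borel_measurable_restrict_space_iff)
  ultimately have "h \<in> borel_measurable (lebesgue_on {a..d})"
    by (simp add: borel_measurable_restrict_space_iff)
  moreover have "AE t in lebesgue_on {a..d}. h t \<in> controls A X a d \<gamma> t"
    using h1 h2 AEb unfolding AE_lebesgue_on_Icc
  proof eventually_elim
    case (elim t)
    then show ?case using c1[of "h1 t" t] c2[of "h2 t" t] by (auto simp: h_def)
  qed
  moreover have "abs_continuous_curve A a d \<gamma>"
    unfolding \<gamma>_def using charts ac1 ac2 \<open>\<gamma>1 b = q\<close> \<open>\<gamma>2 b = q\<close> \<open>a < b\<close> \<open>b < d\<close>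
    by (intro abs_continuous_curve_concat) auto
  ultimately show "admissible A X a d \<gamma> p r"
    using \<open>a < b\<close> \<open>b < d\<close> \<open>\<gamma>1 a = p\<close> \<open>\<gamma>2 d = r\<close> unfolding admissible_def by (auto simp: \<gamma>_def)
  let ?m = "\<lambda>t. ennreal (norm (min_control A X a d \<gamma> t)) * indicator {a..d} t"
  have ad: "a < d" using \<open>a < b\<close> \<open>b < d\<close> by simp
  have "CC_length A X a d \<gamma> \<le> (\<integral>\<^sup>+ t. ?m t * indicator {..b} t \<partial>lebesgue) + (\<integral>\<^sup>+ t. ?m t * indicator {b..} t \<partial>lebesgue)"
    unfolding CC_length_lebesgue by (rule nn_integral_split_le) (auto split: split_indicator)
  also have "\<dots> \<le> CC_length A X a b \<gamma>1 + CC_length A X b d \<gamma>2"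
    unfolding CC_length_lebesgue
  proof (intro add_mono nn_integral_mono_AE)
    show "AE t in lebesgue. ?m t * indicator {..b} t \<le> ennreal (norm (min_control A X a b \<gamma>1 t)) * indicator {a..b} t"
      using admissible_AE_min_control[OF adm1, unfolded AE_lebesgue_on_Icc] AEb
    proof eventually_elim
      case (elim t)
      show ?case
      proof (cases "t \<in> {a..<b}")
        case True
        with elim have "norm (min_control A X a d \<gamma> t) \<le> norm (min_control A X a b \<gamma>1 t)"
          using \<open>b < d\<close> by (intro min_control_in_controls(2)[OF ad] c1) auto
        then show ?thesis using True \<open>b < d\<close> by (auto simp: ennreal_leI)
      qed (use elim in \<open>auto split: split_indicator\<close>)
    qed
    show "AE t in lebesgue. ?m t * indicator {b..} t \<le> ennreal (norm (min_control A X b d \<gamma>2 t)) * indicator {b..d} t"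
      using admissible_AE_min_control[OF adm2, unfolded AE_lebesgue_on_Icc] AEb
    proof eventually_elim
      case (elim t)
      show ?case
      proof (cases "t \<in> {b<..d}")
        case True
        with elim have "norm (min_control A X a d \<gamma> t) \<le> norm (min_control A X b d \<gamma>2 t)"
          using \<open>a < b\<close> by (intro min_control_in_controls(2)[OF ad] c2) auto
        then show ?thesis using True \<open>a < b\<close> by (auto simp: ennreal_leI)
      qed (use elim in \<open>auto split: split_indicator\<close>)
    qed
  qed
  finally show "CC_length A X a d \<gamma> \<le> CC_length A X a b \<gamma>1 + CC_length A X b d \<gamma>2" .
qed

lemma CC_dist_le_CC_length:
  "admissible A X a b \<gamma> p q \<Longrightarrow> CC_dist A X p q \<le> CC_length A X a b \<gamma>"
  unfolding CC_dist_def by (rule Inf_lower) blast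

lemma CC_dist_lessE:
  assumes "CC_dist A X p q < R"
  obtains a b \<gamma> where "admissible A X a b \<gamma> p q" "CC_length A X a b \<gamma> < R"
  using assms unfolding CC_dist_def Inf_less_iff by blast

section \<open>The upper bound\<close>

lemma CC_diam_ball_le:
  assumes charts: "\<And>c. c \<in> A \<Longrightarrow> is_chart c" and "r > 0"
  shows "CC_diam A X (CC_ball A X q r) \<le> ennreal (2 * r)"
  unfolding CC_diam_def
proof (intro SUP_least)
  fix x y assume "x \<in> CC_ball A X q r" "y \<in> CC_ball A X q r"
  then have "CC_dist A X q x < ennreal r" "CC_dist A X q y < ennreal r" by (auto simp: CC_ball_def)
  then obtain a b \<gamma> c d \<eta> where 1: "admissible A X a b \<gamma> q x" "CC_length A X a b \<gamma> < ennreal r"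
    and 2: "admissible A X c d \<eta> q y" "CC_length A X c d \<eta> < ennreal r"
    by (metis CC_dist_lessE)
  \<comment> \<open>Reflecting at \<open>(a + c) / 2\<close> makes the reversed first curve end at time \<open>c\<close>.\<close>
  have "admissible A X (a + c - b) c (\<lambda>t. \<gamma> (a + c - t)) x q"
    "CC_length A X (a + c - b) c (\<lambda>t. \<gamma> (a + c - t)) \<le> CC_length A X a b \<gamma>"
    using admissible_reflect[OF 1(1), of "a + c"] by auto
  note rev = this
  have "CC_dist A X x y \<le> CC_length A X (a + c - b) c (\<lambda>t. \<gamma> (a + c - t)) + CC_length A X c d \<eta>"
    using admissible_concat[OF charts rev(1) 2(1)] CC_dist_le_CC_length order_trans by blast
  also have "\<dots> \<le> ennreal r + ennreal r"
    using rev(2) 1(2) 2(2) by (intro add_mono) auto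
  also have "\<dots> = ennreal (2 * r)" using \<open>r > 0\<close> by (simp flip: ennreal_plus)
  finally show "CC_dist A X x y \<le> ennreal (2 * r)" .
qed

section \<open>Curves in a chart\<close>

lemma chart_homeomorphism:
  assumes "is_chart c"
  shows "homeomorphism (chart_dom c) (chart_map c ` chart_dom c) (chart_map c) (inv_into (chart_dom c) (chart_map c))"
proof -
  obtain \<psi> where \<psi>: "homeomorphism (chart_dom c) (chart_map c ` chart_dom c) (chart_map c) \<psi>"
    using assms by (auto simp: is_chart_def)
  have inj: "inj_on (chart_map c) (chart_dom c)"
    by (rule inj_on_inverseI[of _ \<psi>]) (rule homeomorphism_apply1[OF \<psi>])
  have eq: "\<psi> y = inv_into (chart_dom c) (chart_map c) y" if "y \<in> chart_map c ` chart_dom c" for y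
    using that \<psi> inj by (auto simp: homeomorphism_def)
  then show ?thesis by (intro homeomorphism_cong[OF \<psi>]) auto
qed

text \<open>A linear functional \<open>w\<close> that is bounded by \<open>1\<close> on unit controls grows along a curve by at most the
  length of the curve.\<close>
lemma curve_functional_bound:
  assumes adm: "admissible A X a b \<gamma> p q" and c: "c \<in> A" and t: "a \<le> t" "t \<le> b"
    and W: "\<gamma> ` {a..t} \<subseteq> W" "W \<subseteq> chart_dom c"
    and bound: "\<And>z h. z \<in> W \<Longrightarrow> \<bar>w \<bullet> (\<Sum>j\<in>UNIV. (h $ j) *\<^sub>R X j z c)\<bar> \<le> norm h"
  shows "ennreal \<bar>w \<bullet> (chart_map c (\<gamma> t) - chart_map c (\<gamma> a))\<bar> \<le> CC_length A X a b \<gamma>"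
proof -
  let ?f = "\<lambda>s. w \<bullet> chart_map c (\<gamma> s)"
  let ?m = "\<lambda>s. ennreal (norm (min_control A X a b \<gamma> s))"
  have "abs_continuous a t (chart_map c \<circ> \<gamma>)"
    using adm c t W unfolding admissible_def abs_continuous_curve_def by auto
  then have ac: "abs_continuous a t ?f"
  proof (rule abs_continuousI_dist_le)
    show "dist (?f r) (?f s) \<le> norm w * dist ((chart_map c \<circ> \<gamma>) r) ((chart_map c \<circ> \<gamma>) s)" for r s
      by (simp add: dist_norm Cauchy_Schwarz_ineq2 flip: inner_diff_right)
  qed simp
  have der: "AE s in lebesgue_on {a..t}. \<exists>D. (?f has_vector_derivative D) (at s within {a..t}) \<and> ennreal \<bar>D\<bar> \<le> ?m s"
    using admissible_AE_min_control[OF adm] unfolding AE_lebesgue_on_Icc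
  proof eventually_elim
    case (elim s)
    show ?case
    proof
      assume s: "s \<in> {a..t}"
      then have sW: "\<gamma> s \<in> W" using W by auto
      let ?v = "\<Sum>j\<in>UNIV. (min_control A X a b \<gamma> s $ j) *\<^sub>R X j (\<gamma> s) c"
      have "((chart_map c \<circ> \<gamma>) has_vector_derivative ?v) (at s within {a..b})"
        using elim s t sW W c unfolding controls_def has_velocity_def by auto
      then have "((chart_map c \<circ> \<gamma>) has_vector_derivative ?v) (at s within {a..t})"
        by (rule has_vector_derivative_within_subset) (use t in auto)
      from bounded_linear.has_vector_derivative[OF bounded_linear_inner_right[of w] this]
      have "(?f has_vector_derivative w \<bullet> ?v) (at s within {a..t})" by simp
      moreover have "ennreal \<bar>w \<bullet> ?v\<bar> \<le> ?m s" using bound[OF sW] by (intro ennreal_leI)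
      ultimately show "\<exists>D. (?f has_vector_derivative D) (at s within {a..t}) \<and> ennreal \<bar>D\<bar> \<le> ?m s" by blast
    qed
  qed
  have "ennreal \<bar>?f t - ?f a\<bar> \<le> (\<integral>\<^sup>+ s. ?m s \<partial>lebesgue_on {a..t})"
    by (rule abs_continuous_bound[OF t(1) ac der])
  also have "\<dots> = (\<integral>\<^sup>+ s. ?m s * indicator {a..t} s \<partial>lebesgue)"
    by (rule nn_integral_restrict_space) simp
  also have "\<dots> \<le> CC_length A X a b \<gamma>"
    unfolding CC_length_lebesgue using t by (intro nn_integral_mono) (auto split: split_indicator)
  finally show ?thesis by (simp add: inner_diff_right)
qed

lemma curve_displacement_bound:
  assumes "admissible A X a b \<gamma> p q" "c \<in> A" "a \<le> t" "t \<le> b" "\<gamma> ` {a..t} \<subseteq> W" "W \<subseteq> chart_dom c"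
    and "C > 0"
    and bound: "\<And>z h. z \<in> W \<Longrightarrow> norm (\<Sum>j\<in>UNIV. (h $ j) *\<^sub>R X j z c) \<le> C * norm h"
  shows "ennreal (dist (chart_map c (\<gamma> a)) (chart_map c (\<gamma> t)) / C) \<le> CC_length A X a b \<gamma>"
proof -
  define \<Delta> where "\<Delta> = chart_map c (\<gamma> t) - chart_map c (\<gamma> a)"
  \<comment> \<open>The functional that measures the displacement itself.\<close>
  define w where "w = (1 / C) *\<^sub>R sgn \<Delta>"
  have nw: "norm w \<le> 1 / C" using \<open>C > 0\<close> by (auto simp: w_def norm_sgn)
  have "\<bar>w \<bullet> (\<Sum>j\<in>UNIV. (h $ j) *\<^sub>R X j z c)\<bar> \<le> norm h" if "z \<in> W" for z h
  proof -
    have "\<bar>w \<bullet> (\<Sum>j\<in>UNIV. (h $ j) *\<^sub>R X j z c)\<bar> \<le> norm w * norm (\<Sum>j\<in>UNIV. (h $ j) *\<^sub>R X j z c)"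
      by (rule Cauchy_Schwarz_ineq2)
    also have "\<dots> \<le> (1 / C) * (C * norm h)"
      using nw bound[OF that] \<open>C > 0\<close> by (intro mult_mono) auto
    finally show ?thesis using \<open>C > 0\<close> by simp
  qed
  from curve_functional_bound[OF assms(1-6) this]
  have "ennreal \<bar>w \<bullet> \<Delta>\<bar> \<le> CC_length A X a b \<gamma>" by (simp add: \<Delta>_def)
  moreover have "w \<bullet> \<Delta> = norm \<Delta> / C"
    by (cases "\<Delta> = 0") (simp_all add: w_def sgn_div_norm power2_norm_eq_inner[symmetric] power2_eq_square)
  ultimately show ?thesis using \<open>C > 0\<close> by (simp add: \<Delta>_def dist_norm norm_minus_commute)
qed

text \<open>A short curve cannot leave a chart ball. Up to the first exit time \<open>\<tau>\<close> the curve stays in the preimage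
  \<open>K\<close> of a smaller closed ball. This preimage is compact, hence closed in the Hausdorff space \<open>'a\<close>, so the
  curve is still in \<open>K\<close> at time \<open>\<tau>\<close>.\<close>
lemma curve_confined:
  fixes A :: "('a::t2_space, 'n::finite) chart set"
  assumes chart: "is_chart c" and c: "c \<in> A" and adm: "admissible A X a b \<gamma> p q"
    and cb: "ball z0 R \<subseteq> chart_map c ` chart_dom c" and "C > 0"
    and bound: "\<And>z h. z \<in> chart_dom c \<Longrightarrow> chart_map c z \<in> ball z0 R \<Longrightarrow>
       norm (\<Sum>j\<in>UNIV. (h $ j) *\<^sub>R X j z c) \<le> C * norm h"
    and p: "p \<in> chart_dom c" "dist z0 (chart_map c p) \<le> \<rho>" "\<rho> < R"
    and short: "CC_length A X a b \<gamma> < ennreal ((R - \<rho>) / C)"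
  shows "\<gamma> ` {a..b} \<subseteq> {z \<in> chart_dom c. chart_map c z \<in> ball z0 R}"
proof (rule ccontr)
  let ?W = "{z \<in> chart_dom c. chart_map c z \<in> ball z0 R}"
  let ?\<psi> = "inv_into (chart_dom c) (chart_map c)"
  assume not: "\<not> \<gamma> ` {a..b} \<subseteq> ?W"
  have ab: "a < b" and \<gamma>a: "\<gamma> a = p" and cont: "continuous_on {a..b} \<gamma>"
    using adm by (auto simp: admissible_def abs_continuous_curve_def)
  have hom: "homeomorphism (chart_dom c) (chart_map c ` chart_dom c) (chart_map c) ?\<psi>"
    by (rule chart_homeomorphism[OF chart])
  have "open (chart_dom c \<inter> chart_map c -` ball z0 R)"
    using chart continuous_on_chart_map[OF chart] by (intro continuous_open_preimage) (auto simp: is_chart_def)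
  moreover have "chart_dom c \<inter> chart_map c -` ball z0 R = ?W" by blast
  ultimately have "open ?W" by metis
  define T where "T = {a..b} \<inter> \<gamma> -` (- ?W)"
  have "closed T" unfolding T_def
    using \<open>open ?W\<close> by (intro continuous_closed_preimage cont) auto
  moreover have "T \<noteq> {}" using not by (auto simp: T_def)
  moreover have "bounded T" by (rule bounded_subset[of "{a..b}"]) (auto simp: T_def)
  ultimately obtain \<tau> where \<tau>: "\<tau> \<in> T" "\<And>t. t \<in> T \<Longrightarrow> \<tau> \<le> t"
    using compact_attains_inf[of T] by (auto simp: compact_eq_bounded_closed)
  have before: "\<gamma> t \<in> ?W" if "a \<le> t" "t < \<tau>" for t
    using \<tau>(2)[of t] \<tau>(1) that unfolding T_def by force
  have "p \<in> ?W" using p by (auto simp: mem_ball)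
  then have "\<tau> \<noteq> a" using \<tau>(1) \<gamma>a by (auto simp: T_def)
  then have \<tau>ab: "a < \<tau>" "\<tau> \<le> b" using \<tau>(1) by (auto simp: T_def)
  obtain l where l: "0 \<le> l" "CC_length A X a b \<gamma> = ennreal l"
    using short by (cases "CC_length A X a b \<gamma>") auto
  have lR: "\<rho> + C * l < R"
    using short l \<open>C > 0\<close> p(3) by (simp add: ennreal_less_iff field_simps)
  define K where "K = ?\<psi> ` cball z0 (\<rho> + C * l)"
  have sub: "cball z0 (\<rho> + C * l) \<subseteq> chart_map c ` chart_dom c"
    using lR cb by force
  have "compact K" unfolding K_def
    by (rule compact_continuous_image[OF continuous_on_subset[OF homeomorphism_cont2[OF hom] sub] compact_cball])
  then have "closed K" by (rule compact_imp_closed)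
  have "\<gamma> ` {a..<\<tau>} \<subseteq> K"
  proof (intro image_subsetI)
    fix t assume t: "t \<in> {a..<\<tau>}"
    have "ennreal (dist (chart_map c (\<gamma> a)) (chart_map c (\<gamma> t)) / C) \<le> ennreal l"
      unfolding l(2)[symmetric]
      by (rule curve_displacement_bound[where W = ?W, OF adm c])
        (use t \<tau>ab before \<open>C > 0\<close> bound in auto)
    then have "dist (chart_map c p) (chart_map c (\<gamma> t)) \<le> C * l"
      using \<gamma>a \<open>C > 0\<close> l(1) by (simp add: field_simps)
    then have "dist z0 (chart_map c (\<gamma> t)) \<le> \<rho> + C * l"
      using p(2) dist_triangle[of z0 "chart_map c (\<gamma> t)" "chart_map c p"] by linarith
    moreover have "\<gamma> t = ?\<psi> (chart_map c (\<gamma> t))"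
      using before[of t] t homeomorphism_apply1[OF hom] by auto
    ultimately show "\<gamma> t \<in> K" unfolding K_def by (intro image_eqI[of _ _ "chart_map c (\<gamma> t)"]) auto
  qed
  moreover have "closure {a..<\<tau>} = {a..\<tau>}" using \<tau>ab by simp
  moreover have "continuous_on {a..\<tau>} \<gamma>" using \<tau>ab by (intro continuous_on_subset[OF cont]) auto
  ultimately have "\<gamma> ` {a..\<tau>} \<subseteq> K" using image_closure_subset[of "{a..<\<tau>}" \<gamma> K] \<open>closed K\<close> by simp
  moreover have "K \<subseteq> ?W"
  proof
    fix x assume "x \<in> K"
    then obtain z where z: "z \<in> cball z0 (\<rho> + C * l)" "x = ?\<psi> z" by (auto simp: K_def)
    then have "z \<in> chart_map c ` chart_dom c" using sub by blast
    then have "chart_map c x = z" "x \<in> chart_dom c"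
      using homeomorphism_apply2[OF hom] homeomorphism_image2[OF hom] z(2) by auto
    then show "x \<in> ?W" using z(1) lR by auto
  qed
  moreover have "\<tau> \<in> {a..\<tau>}" using \<tau>ab by simp
  ultimately have "\<gamma> \<tau> \<in> ?W" by blast
  then show False using \<tau>(1) unfolding T_def by blast
qed

text \<open>An integral curve in one chart is admissible: the transition maps carry its velocity to the
  velocities in all other charts.\<close>
lemma integral_curve_admissible:
  fixes A :: "('a::{t2_space,second_countable_topology}, 'n::finite) chart set"
    and X :: "'m::finite \<Rightarrow> 'a \<Rightarrow> ('a, 'n) tvec" and u :: "real ^ 'm"
  assumes CC: "CC_structure A X" and c: "c \<in> A" and T: "0 < T" and u: "norm u \<le> 1"
    and x: "\<And>t. t \<in> {0..T} \<Longrightarrow> x t \<in> chart_map c ` chart_dom c"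
    and \<gamma>: "\<And>t. \<gamma> t = inv_into (chart_dom c) (chart_map c) (x t)"
    and der: "\<And>t. t \<in> {0..T} \<Longrightarrow>
       (x has_vector_derivative (\<Sum>j\<in>UNIV. (u $ j) *\<^sub>R X j (\<gamma> t) c)) (at t within {0..T})"
  shows "admissible A X 0 T \<gamma> (\<gamma> 0) (\<gamma> T)" and "CC_length A X 0 T \<gamma> \<le> ennreal T"
proof -
  have chart: "is_chart c'" if "c' \<in> A" for c' using CC that by (auto simp: CC_structure_def smooth_atlas_def)
  have vf: "continuous_vector_field A (X j)" for j using CC by (auto simp: CC_structure_def)
  let ?\<psi> = "inv_into (chart_dom c) (chart_map c)"
  let ?v = "\<lambda>t c'. \<Sum>j\<in>UNIV. (u $ j) *\<^sub>R X j (\<gamma> t) c'"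
  have hom: "homeomorphism (chart_dom c) (chart_map c ` chart_dom c) (chart_map c) ?\<psi>"
    by (rule chart_homeomorphism[OF chart[OF c]])
  have \<gamma>dom: "\<gamma> t \<in> chart_dom c" and \<gamma>x: "chart_map c (\<gamma> t) = x t" if "t \<in> {0..T}" for t
    using x[OF that] homeomorphism_apply2[OF hom] homeomorphism_image2[OF hom] by (auto simp: \<gamma>)
  have "continuous_on {0..T} x"
    unfolding continuous_on_eq_continuous_within using der has_vector_derivative_continuous by blast
  then have "continuous_on {0..T} (\<lambda>t. ?\<psi> (x t))"
    by (rule continuous_on_compose2[OF homeomorphism_cont2[OF hom]]) (use x in blast)
  then have cont: "continuous_on {0..T} \<gamma>" by (simp add: \<gamma>[abs_def])
  have vel: "has_velocity A \<gamma> 0 T t (?v t)" if t: "t \<in> {0..T}" for t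
    unfolding has_velocity_def
  proof (intro ballI impI)
    fix c' assume c': "c' \<in> A" "\<gamma> t \<in> chart_dom c'"
    define D where "D = frechet_derivative (transition c c') (at (x t))"
    have "Ck_on (Suc 0) (chart_map c ` (chart_dom c \<inter> chart_dom c')) (transition c c')"
      using CC c c'(1) unfolding CC_structure_def smooth_atlas_def smooth_on_def by blast
    moreover have "x t \<in> chart_map c ` (chart_dom c \<inter> chart_dom c')"
      using \<gamma>dom[OF t] c'(2) \<gamma>x[OF t] by (metis IntI imageI)
    ultimately have "transition c c' differentiable (at (x t))"
      unfolding Ck_on.simps by blast
    then have D: "(transition c c' has_derivative D) (at (x t))"
      unfolding D_def by (simp add: frechet_derivative_works)
    then have "linear D" by (rule has_derivative_linear)
    have "D (?v t c) = (\<Sum>j\<in>UNIV. (u $ j) *\<^sub>R D (X j (\<gamma> t) c))"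
      using \<open>linear D\<close> by (simp add: linear_sum linear_scale)
    also have "\<dots> = ?v t c'"
    proof (intro sum.cong refl)
      fix j
      have "tangent_vector A (\<gamma> t) (X j (\<gamma> t))" using vf[of j] by (auto simp: continuous_vector_field_def)
      then have "X j (\<gamma> t) c' = D (X j (\<gamma> t) c)"
        using c c' \<gamma>dom[OF t] unfolding tangent_vector_def D_def \<gamma>x[OF t, symmetric] by blast
      then show "(u $ j) *\<^sub>R D (X j (\<gamma> t) c) = (u $ j) *\<^sub>R X j (\<gamma> t) c'" by simp
    qed
    finally have Dv: "D (?v t c) = ?v t c'" .
    have "((transition c c' \<circ> x) has_derivative (D \<circ> (\<lambda>h. h *\<^sub>R ?v t c))) (at t within {0..T})"
      by (rule diff_chain_within[OF der[OF t, unfolded has_vector_derivative_def] has_derivative_at_withinI[OF D]])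
    moreover have "D \<circ> (\<lambda>h. h *\<^sub>R ?v t c) = (\<lambda>h. h *\<^sub>R ?v t c')"
      using \<open>linear D\<close> Dv by (auto simp: linear_scale)
    ultimately have "((transition c c' \<circ> x) has_vector_derivative ?v t c') (at t within {0..T})"
      by (simp add: has_vector_derivative_def)
    moreover have "transition c c' \<circ> x = chart_map c' \<circ> \<gamma>"
      by (auto simp: transition_def \<gamma>)
    ultimately show "((chart_map c' \<circ> \<gamma>) has_vector_derivative ?v t c') (at t within {0..T})" by simp
  qed
  have "abs_continuous s t (chart_map c' \<circ> \<gamma>)"
    if c': "c' \<in> A" and st: "0 \<le> s \<and> s \<le> t \<and> t \<le> T \<and> \<gamma> ` {s..t} \<subseteq> chart_dom c'" for c' s t
  proof -
    have \<gamma>st: "continuous_on {s..t} \<gamma>"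
      by (rule continuous_on_subset[OF cont]) (use st in auto)
    have "continuous_on {s..t} (\<lambda>r. X j (\<gamma> r) c')" for j
    proof (rule continuous_on_compose2[OF _ \<gamma>st])
      show "continuous_on (chart_dom c') (\<lambda>p. X j p c')"
        using vf[of j] c' by (simp add: continuous_vector_field_def)
    qed (use st in blast)
    then have "continuous_on {s..t} (\<lambda>r. ?v r c')" by (intro continuous_intros)
    then have "bounded ((\<lambda>r. ?v r c') ` {s..t})"
      by (intro compact_imp_bounded compact_continuous_image) auto
    then obtain B where "B > 0" and B: "\<And>r. r \<in> {s..t} \<Longrightarrow> norm (?v r c') \<le> B"
      by (auto simp: bounded_pos)
    have d: "((chart_map c' \<circ> \<gamma>) has_derivative (\<lambda>h. h *\<^sub>R ?v r c')) (at r within {s..t})" if "r \<in> {s..t}" for r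
    proof -
      have "\<gamma> r \<in> chart_dom c'" "r \<in> {0..T}" using st that by auto
      then have "((chart_map c' \<circ> \<gamma>) has_vector_derivative ?v r c') (at r within {0..T})"
        using vel c' unfolding has_velocity_def by blast
      then have "((chart_map c' \<circ> \<gamma>) has_vector_derivative ?v r c') (at r within {s..t})"
        by (rule has_vector_derivative_within_subset) (use st in auto)
      then show ?thesis by (simp add: has_vector_derivative_def)
    qed
    have "norm ((chart_map c' \<circ> \<gamma>) r' - (chart_map c' \<circ> \<gamma>) r) \<le> B * norm (r' - r)" if "r \<in> {s..t}" "r' \<in> {s..t}" for r r'
    proof (rule differentiable_bound[where S = "{s..t}" and f' = "\<lambda>r h. h *\<^sub>R ?v r c'"])
      show "((chart_map c' \<circ> \<gamma>) has_derivative (\<lambda>h. h *\<^sub>R ?v y c')) (at y within {s..t})" if "y \<in> {s..t}" for y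
        by (rule d[OF that])
      show "onorm (\<lambda>h. h *\<^sub>R ?v y c') \<le> B" if "y \<in> {s..t}" for y
        using B[OF that] \<open>B > 0\<close> by (intro onorm_bound) (auto simp: mult.commute[of B] intro!: mult_left_mono)
    qed (use that in auto)
    then have "dist ((chart_map c' \<circ> \<gamma>) r) ((chart_map c' \<circ> \<gamma>) r') \<le> B * dist r r'"
      if "r \<in> {s..t}" "r' \<in> {s..t}" for r r'
      using that by (simp add: dist_norm)
    then show ?thesis
      using \<open>B > 0\<close> by (intro abs_continuousI_dist_le[OF abs_continuous_id, of B]) auto
  qed
  then have ac: "abs_continuous_curve A 0 T \<gamma>"
    using cont unfolding abs_continuous_curve_def by blast
  have ctrl: "u \<in> controls A X 0 T \<gamma> t" if "t \<in> {0..T}" for t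
    using vel[OF that] by (simp add: controls_def)
  then have "AE t in lebesgue_on {0..T}. u \<in> controls A X 0 T \<gamma> t"
    by (intro AE_I2) auto
  then show "admissible A X 0 T \<gamma> (\<gamma> 0) (\<gamma> T)"
    using T ac unfolding admissible_def by (intro conjI exI[of _ "\<lambda>_. u"]) auto
  have "CC_length A X 0 T \<gamma> \<le> (\<integral>\<^sup>+ t. 1 \<partial>lebesgue_on {0..T})"
    unfolding CC_length_def
  proof (rule nn_integral_mono)
    fix t assume "t \<in> space (lebesgue_on {0..T})"
    then have t: "t \<in> {0..T}" by simp
    show "ennreal (norm (min_control A X 0 T \<gamma> t)) \<le> 1"
      using min_control_in_controls(2)[OF T t ctrl[OF t]] u by (simp add: ennreal_le_1)
  qed
  also have "\<dots> = ennreal T" using T by (simp add: emeasure_restrict_space)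
  finally show "CC_length A X 0 T \<gamma> \<le> ennreal T" .
qed

text \<open>Following the field with constant control \<open>v\<close> from \<open>q\<close> for a time \<open>T\<close> costs at most \<open>T\<close> and increases
  \<open>w\<close> by at least \<open>\<beta> T\<close>.\<close>
lemma exists_short_flow:
  fixes A :: "('a::{t2_space,second_countable_topology}, 'n::finite) chart set"
    and X :: "'m::finite \<Rightarrow> 'a \<Rightarrow> ('a, 'n) tvec" and v :: "real ^ 'm"
  assumes CC: "CC_structure A X" and c: "c \<in> A" and T: "0 < T" and v: "norm v \<le> 1"
    and cb: "cball z0 R \<subseteq> chart_map c ` chart_dom c"
    and bound: "\<And>y. y \<in> chart_dom c \<Longrightarrow> chart_map c y \<in> cball z0 R \<Longrightarrow>
       norm (\<Sum>j\<in>UNIV. (v $ j) *\<^sub>R X j y c) \<le> C"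
    and low: "\<And>y. y \<in> chart_dom c \<Longrightarrow> chart_map c y \<in> cball z0 R \<Longrightarrow>
       \<beta> \<le> w \<bullet> (\<Sum>j\<in>UNIV. (v $ j) *\<^sub>R X j y c)"
    and q: "q \<in> chart_dom c" "dist z0 (chart_map c q) + C * T \<le> R" "chart_map c q \<in> cball z0 R"
  obtains y where "y \<in> chart_dom c" "dist z0 (chart_map c y) \<le> dist z0 (chart_map c q) + C * T"
    "CC_dist A X q y \<le> ennreal T" "\<beta> * T \<le> w \<bullet> (chart_map c y - chart_map c q)"
proof -
  let ?\<psi> = "inv_into (chart_dom c) (chart_map c)"
  let ?G = "\<lambda>y. \<Sum>j\<in>UNIV. (v $ j) *\<^sub>R X j y c"
  have chart: "is_chart c" using CC c by (auto simp: CC_structure_def smooth_atlas_def)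
  have hom: "homeomorphism (chart_dom c) (chart_map c ` chart_dom c) (chart_map c) ?\<psi>"
    by (rule chart_homeomorphism[OF chart])
  have C0: "C \<ge> 0" using norm_ge_zero bound[OF q(1)] q(3) by (meson order_trans)
  have R0: "0 \<le> R" using q(3) order_trans[OF zero_le_dist, of z0 "chart_map c q" R] by simp
  \<comment> \<open>Projecting onto the ball extends the field to a bounded continuous field on the whole space; the
    solution never leaves the ball, so that the extension does not matter.\<close>
  let ?cl = "closest_point (cball z0 R)"
  define F where "F z = ?G (?\<psi> (?cl z))" for z
  have cl: "?cl z \<in> cball z0 R" for z using R0 by (intro closest_point_in_set) auto
  have inv: "?\<psi> z \<in> chart_dom c" "chart_map c (?\<psi> z) = z" if "z \<in> cball z0 R" for z
  proof -
    have "z \<in> chart_map c ` chart_dom c" using that cb by blast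
    then show "?\<psi> z \<in> chart_dom c" "chart_map c (?\<psi> z) = z"
      by (auto intro: inv_into_into f_inv_into_f)
  qed
  have "continuous_on UNIV (\<lambda>z. X j (?\<psi> (?cl z)) c)" for j
  proof (rule continuous_on_compose2[of "chart_dom c" "\<lambda>y. X j y c"])
    show "continuous_on (chart_dom c) (\<lambda>y. X j y c)"
      using CC c by (auto simp: CC_structure_def continuous_vector_field_def)
    show "continuous_on UNIV (\<lambda>z. ?\<psi> (?cl z))"
    proof (rule continuous_on_compose2[OF homeomorphism_cont2[OF hom]])
      show "continuous_on UNIV ?cl" using R0 by (intro continuous_on_closest_point) auto
    qed (use cl cb in blast)
    show "(\<lambda>z. ?\<psi> (?cl z)) ` UNIV \<subseteq> chart_dom c" using inv(1)[OF cl] by blast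
  qed
  then have contF: "continuous_on UNIV F" unfolding F_def by (intro continuous_intros)
  have boundF: "norm (F z) \<le> C" for z
    unfolding F_def using inv[OF cl] cl by (intro bound) auto
  obtain x where x0: "x 0 = chart_map c q"
    and x: "\<And>t. t \<in> {0..T} \<Longrightarrow> (x has_vector_derivative F (x t)) (at t within {0..T})"
    using peano_existence[OF contF boundF less_imp_le[OF T]] by blast
  have disp: "norm (x t - x 0) \<le> C * t" if t: "t \<in> {0..T}" for t
  proof -
    have "norm (x t - x 0) \<le> C * norm (t - 0)"
    proof (rule differentiable_bound[where f = x and S = "{0..T}" and f' = "\<lambda>s h. h *\<^sub>R F (x s)"])
      show "(x has_derivative (\<lambda>h. h *\<^sub>R F (x s))) (at s within {0..T})" if "s \<in> {0..T}" for s
        using x[OF that] by (simp add: has_vector_derivative_def)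
      show "onorm (\<lambda>h. h *\<^sub>R F (x s)) \<le> C" for s
        using boundF[of "x s"] C0 by (intro onorm_bound) (auto simp: mult.commute[of C] intro!: mult_left_mono)
    qed (use t in auto)
    then show ?thesis using t by simp
  qed
  have dist: "dist z0 (x t) \<le> dist z0 (chart_map c q) + C * T" if t: "t \<in> {0..T}" for t
  proof -
    have "dist z0 (x t) \<le> dist z0 (x 0) + dist (x 0) (x t)" by (rule dist_triangle)
    also have "dist (x 0) (x t) \<le> C * t" using disp[OF t] by (simp add: dist_norm norm_minus_commute)
    also have "C * t \<le> C * T" using t C0 by (intro mult_left_mono) auto
    finally show ?thesis using x0 by simp
  qed
  have xin: "x t \<in> cball z0 R" if "t \<in> {0..T}" for t
    using dist[OF that] q(2) by simp
  have Fx: "F (x t) = ?G (?\<psi> (x t))" if "t \<in> {0..T}" for t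
    unfolding F_def using xin[OF that] by (simp add: closest_point_self)
  define \<gamma> where "\<gamma> t = ?\<psi> (x t)" for t
  have xdom: "x t \<in> chart_map c ` chart_dom c" if "t \<in> {0..T}" for t using xin[OF that] cb by blast
  have xder: "(x has_vector_derivative ?G (\<gamma> t)) (at t within {0..T})" if "t \<in> {0..T}" for t
    using x[OF that] Fx[OF that] by (simp add: \<gamma>_def)
  note curve = integral_curve_admissible[OF CC c T v xdom \<gamma>_def xder]
  have "\<gamma> 0 = q" using q(1) homeomorphism_apply1[OF hom] by (simp add: \<gamma>_def x0)
  have TT: "T \<in> {0..T}" using T by simp
  show thesis
  proof
    show "\<gamma> T \<in> chart_dom c" unfolding \<gamma>_def by (rule inv(1)[OF xin[OF TT]])
    have \<gamma>T: "chart_map c (\<gamma> T) = x T" unfolding \<gamma>_def by (rule inv(2)[OF xin[OF TT]])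
    show "dist z0 (chart_map c (\<gamma> T)) \<le> dist z0 (chart_map c q) + C * T"
      unfolding \<gamma>T by (rule dist[OF TT])
    show "CC_dist A X q (\<gamma> T) \<le> ennreal T"
      using CC_dist_le_CC_length[OF curve(1)] curve(2) \<open>\<gamma> 0 = q\<close> by simp
    have I1: "((\<lambda>t. w \<bullet> ?G (\<gamma> t)) has_integral (w \<bullet> x T - w \<bullet> x 0)) {0..T}"
      using T xder by (intro fundamental_theorem_of_calculus bounded_linear.has_vector_derivative[OF bounded_linear_inner_right]) auto
    have I2: "((\<lambda>t. \<beta>) has_integral \<beta> * T) {0..T}"
      using has_integral_const_real[of \<beta> 0 T] T by (simp add: mult.commute)
    have I3: "\<beta> \<le> w \<bullet> ?G (\<gamma> t)" if "t \<in> {0..T}" for t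
      unfolding \<gamma>_def using inv[OF xin[OF that]] xin[OF that] by (intro low) auto
    have "\<beta> * T \<le> w \<bullet> x T - w \<bullet> x 0" by (rule has_integral_le[OF I2 I1 I3])
    then show "\<beta> * T \<le> w \<bullet> (chart_map c (\<gamma> T) - chart_map c q)"
      by (simp add: \<gamma>T x0 inner_diff_right)
  qed
qed

lemma norm_sum_diff_le:
  fixes a b :: "'m::finite \<Rightarrow> 'b::real_normed_vector" and h :: "real ^ 'm"
  assumes "\<And>j. norm (a j - b j) \<le> \<kappa> / CARD('m)"
  shows "norm ((\<Sum>j\<in>UNIV. (h $ j) *\<^sub>R a j) - (\<Sum>j\<in>UNIV. (h $ j) *\<^sub>R b j)) \<le> \<kappa> * norm h"
proof -
  have "norm ((\<Sum>j\<in>UNIV. (h $ j) *\<^sub>R a j) - (\<Sum>j\<in>UNIV. (h $ j) *\<^sub>R b j))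
      = norm (\<Sum>j\<in>UNIV. (h $ j) *\<^sub>R (a j - b j))"
    by (simp add: sum_subtractf scaleR_diff_right)
  also have "\<dots> \<le> (\<Sum>j\<in>(UNIV :: 'm set). norm h * (\<kappa> / CARD('m)))"
  proof (rule sum_norm_le)
    fix j
    show "norm ((h $ j) *\<^sub>R (a j - b j)) \<le> norm h * (\<kappa> / CARD('m))"
      unfolding norm_scaleR using assms[of j] component_le_norm_cart[of h j]
      by (intro mult_mono) auto
  qed
  also have "\<dots> = \<kappa> * norm h" by simp
  finally show ?thesis .
qed

text \<open>Near \<open>p\<close> the frame \<open>h \<mapsto> \<Sum>\<^sub>j h\<^sub>j X\<^sub>j\<close>, read in the chart, is uniformly close to its value at \<open>p\<close>.\<close>
lemma uniform_frame_ball: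
  fixes A :: "('a::{t2_space,second_countable_topology}, 'n::finite) chart set"
    and X :: "'m::finite \<Rightarrow> 'a \<Rightarrow> ('a, 'n) tvec"
  assumes CC: "CC_structure A X" and c: "c \<in> A" and p: "p \<in> chart_dom c" and "\<kappa> > 0"
  obtains R where "R > 0" "cball (chart_map c p) R \<subseteq> chart_map c ` chart_dom c"
    "\<And>y h. y \<in> chart_dom c \<Longrightarrow> chart_map c y \<in> cball (chart_map c p) R \<Longrightarrow>
       norm ((\<Sum>j\<in>UNIV. (h $ j) *\<^sub>R X j y c) - (\<Sum>j\<in>UNIV. (h $ j) *\<^sub>R X j p c)) \<le> \<kappa> * norm (h :: real ^ 'm)"
proof -
  let ?z0 = "chart_map c p" and ?img = "chart_map c ` chart_dom c"
  let ?\<psi> = "inv_into (chart_dom c) (chart_map c)"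
  have chart: "is_chart c" using CC c by (auto simp: CC_structure_def smooth_atlas_def)
  have hom: "homeomorphism (chart_dom c) ?img (chart_map c) ?\<psi>"
    by (rule chart_homeomorphism[OF chart])
  have "open ?img" using chart by (simp add: is_chart_def)
  have z0: "?z0 \<in> ?img" using p by simp
  have "\<kappa> / CARD('m) > 0" using \<open>\<kappa> > 0\<close> by simp
  have "\<forall>\<^sub>F z in nhds ?z0. norm (X j (?\<psi> z) c - X j p c) < \<kappa> / CARD('m)" for j
  proof -
    have "continuous_on ?img (\<lambda>z. X j (?\<psi> z) c)"
    proof (rule continuous_on_compose2[OF _ homeomorphism_cont2[OF hom]])
      show "continuous_on (chart_dom c) (\<lambda>y. X j y c)"
        using CC c by (auto simp: CC_structure_def continuous_vector_field_def)
    qed (use homeomorphism_image2[OF hom] in simp)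
    then have "isCont (\<lambda>z. X j (?\<psi> z) c) ?z0"
      using continuous_on_eq_continuous_at[OF \<open>open ?img\<close>] z0 by blast
    then have "((\<lambda>z. X j (?\<psi> z) c) \<longlongrightarrow> X j (?\<psi> ?z0) c) (nhds ?z0)"
      by (simp add: continuous_at tendsto_nhds_iff)
    from tendstoD[OF this \<open>\<kappa> / CARD('m) > 0\<close>] show ?thesis
      using homeomorphism_apply1[OF hom p] by (simp add: dist_norm)
  qed
  then have "\<forall>\<^sub>F z in nhds ?z0. \<forall>j. norm (X j (?\<psi> z) c - X j p c) < \<kappa> / CARD('m)"
    by (rule eventually_all_finite)
  moreover have "\<forall>\<^sub>F z in nhds ?z0. z \<in> ?img"
    using \<open>open ?img\<close> z0 by (rule eventually_nhds_in_open)
  ultimately have "\<forall>\<^sub>F z in nhds ?z0. (\<forall>j. norm (X j (?\<psi> z) c - X j p c) < \<kappa> / CARD('m)) \<and> z \<in> ?img"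
    by (rule eventually_conj)
  then obtain d where "d > 0" and d: "\<And>z. dist z ?z0 < d \<Longrightarrow>
      (\<forall>j. norm (X j (?\<psi> z) c - X j p c) < \<kappa> / CARD('m)) \<and> z \<in> ?img"
    unfolding eventually_nhds_metric by blast
  show thesis
  proof
    show "d / 2 > 0" using \<open>d > 0\<close> by simp
    show "cball ?z0 (d / 2) \<subseteq> ?img"
    proof
      fix z assume "z \<in> cball ?z0 (d / 2)"
      then have "dist z ?z0 < d" using \<open>d > 0\<close> by (simp add: dist_commute)
      then show "z \<in> ?img" using d by blast
    qed
    fix y :: 'a and h :: "real ^ 'm"
    assume y: "y \<in> chart_dom c" "chart_map c y \<in> cball ?z0 (d / 2)"
    then have "dist (chart_map c y) ?z0 < d" using \<open>d > 0\<close> by (simp add: dist_commute)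
    from d[OF this] have "norm (X j y c - X j p c) \<le> \<kappa> / CARD('m)" for j
      using homeomorphism_apply1[OF hom y(1)] by (auto intro: less_imp_le)
    then show "norm ((\<Sum>j\<in>UNIV. (h $ j) *\<^sub>R X j y c) - (\<Sum>j\<in>UNIV. (h $ j) *\<^sub>R X j p c)) \<le> \<kappa> * norm h"
      by (rule norm_sum_diff_le)
  qed
qed

lemma exists_maximal_direction:
  fixes Y :: "'m::finite \<Rightarrow> 'b::real_normed_vector"
  assumes "Y i \<noteq> 0"
  obtains u :: "real ^ 'm" where "norm u = 1" "(\<Sum>j\<in>UNIV. (u $ j) *\<^sub>R Y j) \<noteq> 0"
    "\<And>h. norm (\<Sum>j\<in>UNIV. (h $ j) *\<^sub>R Y j) \<le> norm (\<Sum>j\<in>UNIV. (u $ j) *\<^sub>R Y j) * norm h"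
proof -
  let ?G = "\<lambda>h :: real ^ 'm. \<Sum>j\<in>UNIV. (h $ j) *\<^sub>R Y j"
  have ax: "?G (axis i 1) = Y i"
  proof -
    have "?G (axis i 1) = (\<Sum>j\<in>UNIV. if j = i then Y j else 0)"
      by (intro sum.cong) (auto simp: axis_def)
    then show ?thesis by simp
  qed
  have axin: "axis i 1 \<in> sphere (0 :: real ^ 'm) 1" by simp
  have "\<exists>u\<in>sphere 0 1. \<forall>h\<in>sphere 0 1. norm (?G h) \<le> norm (?G u)"
  proof (rule continuous_attains_sup)
    show "continuous_on (sphere 0 1) (\<lambda>h. norm (?G h))" by (intro continuous_intros)
    show "sphere (0 :: real ^ 'm) 1 \<noteq> {}" using axin by blast
  qed simp
  then obtain u where u: "u \<in> sphere 0 1" "\<And>h. h \<in> sphere 0 1 \<Longrightarrow> norm (?G h) \<le> norm (?G u)"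
    by blast
  show thesis
  proof
    show "norm u = 1" using u(1) by simp
    have "0 < norm (?G (axis i 1))" using ax assms by simp
    also have "\<dots> \<le> norm (?G u)" by (rule u(2)[OF axin])
    finally show "?G u \<noteq> 0" by simp
    fix h :: "real ^ 'm"
    show "norm (?G h) \<le> norm (?G u) * norm h"
    proof (cases "h = 0")
      case False
      have "?G (norm h *\<^sub>R k) = norm h *\<^sub>R ?G k" for k
        by (simp add: scaleR_sum_right)
      moreover have "norm h *\<^sub>R sgn h = h" using False by (simp add: sgn_div_norm)
      ultimately have "?G h = norm h *\<^sub>R ?G (sgn h)" by metis
      then have "norm (?G h) = norm h * norm (?G (sgn h))" by simp
      also have "\<dots> \<le> norm h * norm (?G u)"
        using False by (intro mult_left_mono u(2)) (auto simp: norm_sgn)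
      finally show ?thesis by (simp add: mult.commute)
    qed simp
  qed
qed

section \<open>The lower bound\<close>

lemma CC_diam_lower_bound:
  fixes A :: "('a::{t2_space,second_countable_topology}, 'n::finite) chart set"
    and X :: "'m::finite \<Rightarrow> 'a \<Rightarrow> ('a, 'n) tvec"
  assumes CC: "CC_structure A X" and e: "0 < e" "e < 1"
  shows "\<exists>V rbar. open V \<and> p \<in> V \<and> rbar > 0 \<and>
    (\<forall>r q. 0 < r \<and> r < rbar \<and> q \<in> V \<longrightarrow> ennreal (2 * r * (1 - e)) \<le> CC_diam A X (CC_ball A X q r))"
proof -
  have "p \<in> (\<Union>c\<in>A. chart_dom c)"
    using CC unfolding CC_structure_def smooth_atlas_def by simp
  then obtain c where c: "c \<in> A" and p: "p \<in> chart_dom c" by blast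
  have chart: "is_chart c" using CC c by (auto simp: CC_structure_def smooth_atlas_def)
  define z0 where "z0 = chart_map c p"
  let ?G = "\<lambda>y (h :: real ^ 'm). \<Sum>j\<in>UNIV. (h $ j) *\<^sub>R X j y c"
  obtain i where "X i p c \<noteq> 0"
    using CC c p unfolding CC_structure_def nonzero_tvec_def by blast
  then obtain u :: "real ^ 'm" where u: "norm u = 1" "?G p u \<noteq> 0"
    and umax: "\<And>h. norm (?G p h) \<le> norm (?G p u) * norm h"
    using exists_maximal_direction[of "\<lambda>j. X j p c"] by blast
  define w where "w = ?G p u"
  define \<sigma> where "\<sigma> = norm w"
  \<comment> \<open>This tolerance, and the time \<open>s = r (1 - e / 2)\<close> below, satisfy
    \<open>s (\<sigma> - \<kappa>) / (\<sigma> + \<kappa>) \<ge> r (1 - e)\<close>.\<close>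
  define \<kappa> where "\<kappa> = \<sigma> * e / 4"
  define C where "C = \<sigma> + \<kappa>"
  have pos: "\<sigma> > 0" "\<kappa> > 0" "C > 0" using u(2) e by (auto simp: \<sigma>_def \<kappa>_def C_def w_def add_pos_pos)
  obtain R where R: "R > 0" "cball z0 R \<subseteq> chart_map c ` chart_dom c"
    and near: "\<And>y h. y \<in> chart_dom c \<Longrightarrow> chart_map c y \<in> cball z0 R \<Longrightarrow> norm (?G y h - ?G p h) \<le> \<kappa> * norm h"
    using uniform_frame_ball[OF CC c p pos(2)] unfolding z0_def by blast
  have GC: "norm (?G y h) \<le> C * norm h" if "y \<in> chart_dom c" "chart_map c y \<in> cball z0 R" for y h
  proof -
    have "norm (?G y h) \<le> norm (?G p h) + norm (?G y h - ?G p h)" by (rule norm_triangle_sub)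
    also have "\<dots> \<le> \<sigma> * norm h + \<kappa> * norm h"
      using umax[of h] near[OF that, of h] by (simp add: \<sigma>_def w_def)
    finally show ?thesis by (simp add: C_def algebra_simps)
  qed
  have wG: "\<sigma> * (\<sigma> - \<kappa>) \<le> w \<bullet> ?G y u" if "y \<in> chart_dom c" "chart_map c y \<in> cball z0 R" for y
  proof -
    have "\<bar>w \<bullet> (?G y u - ?G p u)\<bar> \<le> norm w * norm (?G y u - ?G p u)" by (rule Cauchy_Schwarz_ineq2)
    also have "\<dots> \<le> \<sigma> * \<kappa>" using near[OF that, of u] u(1) by (simp add: \<sigma>_def mult_left_mono)
    finally have "\<bar>w \<bullet> (?G y u - ?G p u)\<bar> \<le> \<sigma> * \<kappa>" .
    moreover have "w \<bullet> ?G y u = w \<bullet> w + w \<bullet> (?G y u - ?G p u)" by (simp add: w_def inner_diff_right)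
    moreover have "w \<bullet> w = \<sigma> * \<sigma>" by (simp add: \<sigma>_def power2_norm_eq_inner[symmetric] power2_eq_square)
    ultimately show ?thesis unfolding right_diff_distrib by linarith
  qed
  define V where "V = {y \<in> chart_dom c. chart_map c y \<in> ball z0 (R / 2)}"
  \<comment> \<open>For \<open>r < rbar\<close>, a curve of speed at most \<open>C\<close> moves by less than \<open>R / 8\<close> in time \<open>r\<close>; the flow from
    \<open>q \<in> V\<close> thus ends within \<open>3 R / 4\<close> of \<open>z0\<close>, and leaving the ball of radius \<open>R\<close> from there costs at least
    \<open>R / (4 C) > 2 r\<close>.\<close>
  define rbar where "rbar = R / (8 * C)"
  have "open (chart_dom c \<inter> chart_map c -` ball z0 (R / 2))"
    using chart continuous_on_chart_map[OF chart] by (intro continuous_open_preimage) (auto simp: is_chart_def)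
  moreover have "chart_dom c \<inter> chart_map c -` ball z0 (R / 2) = V" unfolding V_def by blast
  ultimately have "open V" by metis
  have "ennreal (2 * r * (1 - e)) \<le> CC_diam A X (CC_ball A X q r)"
    if r: "0 < r" "r < rbar" and q: "q \<in> V" for r q
  proof -
    define s where "s = r * (1 - e / 2)"
    have s: "0 < s" "s < r" using r e by (auto simp: s_def)
    have Cr: "C * r < R / 8" using r(2) pos(3) by (simp add: rbar_def field_simps)
    have "C * s < C * r" using s(2) pos(3) by simp
    then have Cs: "C * s < R / 8" using Cr by simp
    have q': "q \<in> chart_dom c" "dist z0 (chart_map c q) + C * s \<le> R" "chart_map c q \<in> cball z0 R"
      and qR: "dist z0 (chart_map c q) < R / 2"
      using q Cs R(1) by (auto simp: V_def)
    have b1: "norm (?G y u) \<le> C" "norm (?G y (- u)) \<le> C"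
      if "y \<in> chart_dom c" "chart_map c y \<in> cball z0 R" for y
      using GC[OF that, of u] GC[OF that, of "- u"] u(1) by auto
    obtain y1 where y1: "y1 \<in> chart_dom c" "CC_dist A X q y1 \<le> ennreal s"
      "\<sigma> * (\<sigma> - \<kappa>) * s \<le> w \<bullet> (chart_map c y1 - chart_map c q)"
      using exists_short_flow[OF CC c s(1) _ R(2) b1(1) wG q'] u(1) by auto
    have wG': "\<sigma> * (\<sigma> - \<kappa>) \<le> (- w) \<bullet> ?G y (- u)" if "y \<in> chart_dom c" "chart_map c y \<in> cball z0 R" for y
      using wG[OF that] by (simp add: sum_negf)
    obtain y2 where y2: "y2 \<in> chart_dom c" "CC_dist A X q y2 \<le> ennreal s"
      "\<sigma> * (\<sigma> - \<kappa>) * s \<le> (- w) \<bullet> (chart_map c y2 - chart_map c q)"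
      "dist z0 (chart_map c y2) \<le> dist z0 (chart_map c q) + C * s"
      using exists_short_flow[OF CC c s(1) _ R(2) b1(2) wG' q'] u(1) by auto
    have "ennreal s < ennreal r" using s by (simp add: ennreal_less_iff)
    then have ball: "y1 \<in> CC_ball A X q r" "y2 \<in> CC_ball A X q r"
      using y1(2) y2(2) by (auto simp: CC_ball_def)
    have gap: "2 * \<sigma> * (\<sigma> - \<kappa>) * s \<le> w \<bullet> (chart_map c y1 - chart_map c y2)"
      using y1(3) y2(3) by (simp add: inner_diff_right)
    have ratio: "2 * r * (1 - e) \<le> 2 * \<sigma> * (\<sigma> - \<kappa>) * s / (\<sigma> * C)"
    proof -
      have "(1 - e) * (1 + e / 4) \<le> (1 - e / 2) * (1 - e / 4)"
        by (simp add: algebra_simps)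
      then have "2 * r * \<sigma> * ((1 - e) * (1 + e / 4)) \<le> 2 * r * \<sigma> * ((1 - e / 2) * (1 - e / 4))"
        using r(1) pos(1) by (intro mult_left_mono) auto
      then have "2 * r * (1 - e) * C \<le> 2 * (\<sigma> - \<kappa>) * s"
        by (simp add: C_def \<kappa>_def s_def algebra_simps)
      then have "2 * r * (1 - e) \<le> 2 * (\<sigma> - \<kappa>) * s / C" using pos(3) by (simp add: field_simps)
      also have "\<dots> = 2 * \<sigma> * (\<sigma> - \<kappa>) * s / (\<sigma> * C)" using pos by simp
      finally show ?thesis .
    qed
    have "ennreal (2 * r * (1 - e)) \<le> CC_length A X a b \<gamma>" if adm: "admissible A X a b \<gamma> y2 y1" for a b \<gamma>
    proof (rule ccontr)
      assume "\<not> ennreal (2 * r * (1 - e)) \<le> CC_length A X a b \<gamma>"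
      then have short: "CC_length A X a b \<gamma> < ennreal (2 * r * (1 - e))" by simp
      have "2 * r * (1 - e) \<le> 2 * r * 1" using e r(1) by (intro mult_left_mono) auto
      also have "\<dots> \<le> (R - 3 / 4 * R) / C" using Cr pos(3) by (simp add: field_simps)
      finally have "CC_length A X a b \<gamma> < ennreal ((R - 3 / 4 * R) / C)"
        using short by (meson ennreal_leI order_less_le_trans)
      then have conf: "\<gamma> ` {a..b} \<subseteq> {z \<in> chart_dom c. chart_map c z \<in> ball z0 R}"
        using curve_confined[OF chart c adm, of z0 R C "3 / 4 * R"] R GC pos(3) y2(1,4) qR Cs by force
      have ab: "a \<le> b" "\<gamma> a = y2" "\<gamma> b = y1" using adm by (auto simp: admissible_def)
      have "\<bar>((1 / (\<sigma> * C)) *\<^sub>R w) \<bullet> ?G z h\<bar> \<le> norm h"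
        if z: "z \<in> {z \<in> chart_dom c. chart_map c z \<in> ball z0 R}" for z h
      proof -
        have "\<bar>w \<bullet> ?G z h\<bar> \<le> norm w * norm (?G z h)" by (rule Cauchy_Schwarz_ineq2)
        also have "\<dots> \<le> \<sigma> * (C * norm h)"
          using GC[of z h] z by (auto simp: \<sigma>_def intro!: mult_left_mono)
        finally show ?thesis using pos by (simp add: abs_mult field_simps)
      qed
      from curve_functional_bound[OF adm c ab(1) order_refl conf _ this]
      have "ennreal \<bar>((1 / (\<sigma> * C)) *\<^sub>R w) \<bullet> (chart_map c y1 - chart_map c y2)\<bar> \<le> CC_length A X a b \<gamma>"
        unfolding ab(2,3) by blast
      moreover have "2 * r * (1 - e) \<le> \<bar>((1 / (\<sigma> * C)) *\<^sub>R w) \<bullet> (chart_map c y1 - chart_map c y2)\<bar>"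
      proof -
        have "2 * \<sigma> * (\<sigma> - \<kappa>) * s / (\<sigma> * C) \<le> w \<bullet> (chart_map c y1 - chart_map c y2) / (\<sigma> * C)"
          using gap pos by (intro divide_right_mono) auto
        also have "\<dots> = ((1 / (\<sigma> * C)) *\<^sub>R w) \<bullet> (chart_map c y1 - chart_map c y2)" by simp
        finally show ?thesis using ratio by linarith
      qed
      ultimately have "ennreal (2 * r * (1 - e)) \<le> CC_length A X a b \<gamma>"
        by (meson ennreal_leI order_trans)
      then show False using short by simp
    qed
    then have "ennreal (2 * r * (1 - e)) \<le> CC_dist A X y2 y1"
      unfolding CC_dist_def by (intro Inf_greatest) auto
    also have "\<dots> \<le> CC_diam A X (CC_ball A X q r)"
      unfolding CC_diam_def using ball by (intro SUP_upper2[of y2] SUP_upper2[of y1]) auto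
    finally show ?thesis .
  qed
  moreover have "p \<in> V" using p R(1) by (simp add: V_def z0_def)
  moreover have "rbar > 0" using R(1) pos(3) by (simp add: rbar_def)
  ultimately show ?thesis using \<open>open V\<close> by blast
qed

theorem theorem1p3:
  fixes A :: "('a::{t2_space,second_countable_topology}, 'n::finite) chart set"
    and X :: "'m::finite \<Rightarrow> 'a \<Rightarrow> ('a, 'n) tvec"
    and p :: 'a and \<epsilon> :: real
  assumes "CC_structure A X" and "\<epsilon> > 0"
  shows "\<exists>V rbar. open V \<and> p \<in> V \<and> rbar > 0 \<and>
    (\<forall>r q. 0 < r \<and> r < rbar \<and> q \<in> V \<longrightarrow>
       ennreal (2 * r * (1 - \<epsilon>)) \<le> CC_diam A X (CC_ball A X q r) \<and>
       CC_diam A X (CC_ball A X q r) \<le> ennreal (2 * r))"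
proof -
  \<comment> \<open>The lower bound is trivial for \<open>\<epsilon> \<ge> 1\<close>, so a smaller constant below \<open>1\<close> may be used.\<close>
  define e where "e = min \<epsilon> (1 / 2)"
  have e: "0 < e" "e < 1" "e \<le> \<epsilon>" using \<open>\<epsilon> > 0\<close> by (auto simp: e_def)
  obtain V rbar where V: "open V" "p \<in> V" "rbar > 0" and low: "\<And>r q. 0 < r \<Longrightarrow> r < rbar \<Longrightarrow> q \<in> V \<Longrightarrow>
      ennreal (2 * r * (1 - e)) \<le> CC_diam A X (CC_ball A X q r)"
    using CC_diam_lower_bound[OF assms(1) e(1,2), of p] by blast
  have charts: "is_chart c" if "c \<in> A" for c
    using assms(1) that by (auto simp: CC_structure_def smooth_atlas_def)
  have "ennreal (2 * r * (1 - \<epsilon>)) \<le> ennreal (2 * r * (1 - e))" if "0 < r" for r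
    using that e(3) by (intro ennreal_leI mult_left_mono) auto
  then show ?thesis
    using V low CC_diam_ball_le[OF charts] by (intro exI[of _ V] exI[of _ rbar]) (blast intro: order_trans)
qed

end
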